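(* Let $K$ be a field and let $\Delta_1$, $\Delta_2$ be simplicial complexes on disjoint finite vertex sets $E_1$ and $E_2$, respectively. For $i=1,2$ let $\mathbf a_i\in\mathbb N^{E_1\cup E_2}$ and $\mathbf b_i\in\{0,1\}^{E_1\cup E_2}$ be such that $\mathrm{supp}(\mathbf a_i)\cap\mathrm{supp}(\mathbf b_i)=\emptyset$ and $\mathrm{supp}(\mathbf a_i)\cup\mathrm{supp}(\mathbf b_i)\subseteq[\Delta_i]$. Then, as $K$-vector spaces, $$T^1(\Delta_1*\Delta_2)_{\mathbf a_1+\mathbf a_2-\mathbf b_1-\mathbf b_2}\cong\begin{cases}0,&\text{if }\mathbf b_1\neq0\text{ and }\mathbf b_2\neq0;\\ 0,&\text{if }\mathrm{supp}(\mathbf a_1)\notin\Delta_1\text{ or }\mathrm{supp}(\mathbf a_2)\notin\Delta_2;\\ T^1(\Delta_1)_{\mathbf a_1-\mathbf b_1},&\text{if }\mathbf b_2=0\text{ and }\mathrm{supp}(\mathbf a_2)\in\Delta_2;\\ T^1(\Delta_2)_{\mathbf a_2-\mathbf b_2},&\text{if }\mathbf b_1=0\text{ and }\mathrm{supp}(\mathbf a_1)\in\Delta_1.\end{cases}$$ In particular, $\Delta_1*\Delta_2$ is rigid if and only if $\Delta_1$ and $\Delta_2$ are rigid.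
   Context: A simplicial complex $\Delta$ on a finite vertex set $V$ is a collection of subsets of $V$ closed under taking subsets and containing $\emptyset$; $[\Delta]$ denotes the set of $v\in V$ with $\{v\}\in\Delta$ (possibly smaller than $V$). Let $S$ be the polynomial ring over $K$ with variables $x_v$, $v\in V$. The Stanley--Reisner ideal $I_\Delta\subseteq S$ is generated by the monomials $x_N=\prod_{v\in N}x_v$ with $N\subseteq V$, $N\notin\Delta$, and $K[\Delta]=S/I_\Delta$. $T^1(\Delta)=T^1(K[\Delta])$ is the cokernel of $\delta^*:\mathrm{Der}_K(S)\to\mathrm{Hom}_S(I_\Delta,S/I_\Delta)$, $\delta^*(\partial)(f)=\partial f+I_\Delta$; it is $\mathbb Z^V$-graded (with $\deg x_v$ the $v$th canonical basis vector). $\Delta$ is called rigid if $T^1(\Delta)=0$. The join $\Delta_1*\Delta_2=\{F\cup G: F\in\Delta_1,\ G\in\Delta_2\}$ is a simplicial complex on $E_1\cup E_2$. $\mathbb N$ denotes the non-negative integers, and the support $\mathrm{supp}$ of a vector is the set of indices of its nonzero entries. A vector of $\mathbb Z^{E_1\cup E_2}$ supported in $E_i$ is also regarded as an element of $\mathbb Z^{E_i}$. *)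

theory Defs
  imports
    "HOL-Library.Poly_Mapping"
    "HOL-Algebra.QuotRing"
    "Jordan_Normal_Form.VS_Connect"
begin

hide_const (open) Modules.module Modules.module_hom

definition simplicial_complex :: "'v set \<Rightarrow> 'v set set \<Rightarrow> bool" where
  "simplicial_complex V \<Delta> \<longleftrightarrow>
     finite V \<and> \<Delta> \<subseteq> Pow V \<and> {} \<in> \<Delta> \<and> (\<forall>F\<in>\<Delta>. \<forall>G. G \<subseteq> F \<longrightarrow> G \<in> \<Delta>)"

text \<open>The set \<open>[\<Delta>]\<close>, which may be a proper subset of the ambient vertex set.\<close>

definition vertices :: "'v set set \<Rightarrow> 'v set" where
  "vertices \<Delta> = {v. {v} \<in> \<Delta>}"

definition simplicial_join :: "'v set set \<Rightarrow> 'v set set \<Rightarrow> 'v set set" where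
  "simplicial_join \<Delta>1 \<Delta>2 = {F \<union> G | F G. F \<in> \<Delta>1 \<and> G \<in> \<Delta>2}"

definition supp :: "('v \<Rightarrow> 'a::zero) \<Rightarrow> 'v set" where
  "supp a = {v. a v \<noteq> 0}"

text \<open>
  The record type of modules extends that of rings; the fields \<open>mult\<close> and \<open>one\<close> of a module
  play no role, and their values below are arbitrary.
\<close>

definition module_iso ::
    "('a, 'r) ring_scheme \<Rightarrow> ('a, 'b, 'm) module_scheme \<Rightarrow> ('a, 'c, 'n) module_scheme \<Rightarrow> bool" where
  "module_iso R M N \<longleftrightarrow> (\<exists>h \<in> module_hom R M N. bij_betw h (carrier M) (carrier N))"

definition zero_module :: "('a, 'b, 'm) module_scheme \<Rightarrow> bool" where
  "zero_module M \<longleftrightarrow> carrier M = {\<zero>\<^bsub>M\<^esub>}"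

text \<open>
  The scalar multiple of a coset \<open>X\<close> is the coset of \<open>r \<odot> x\<close> for any \<open>x \<in> X\<close>;
  the union below is over equal sets.
\<close>

definition quot_module :: "('a, 'b, 'm) module_scheme \<Rightarrow> 'b set \<Rightarrow> ('a, 'b set) module" where
  "quot_module M N =
     \<lparr>carrier = a_rcosets\<^bsub>M\<^esub> N, mult = (\<lambda>X Y. N), one = N, zero = N, add = set_add M,
      smult = (\<lambda>r X. \<Union>x\<in>X. N +>\<^bsub>M\<^esub> (r \<odot>\<^bsub>M\<^esub> x))\<rparr>"

text \<open>
  Homomorphisms are normalised to be \<open>undefined\<close> outside the carrier of the source, so that
  equality in the module of homomorphisms is equality of maps.
\<close>

definition Hom_module ::
    "('a, 'r) ring_scheme \<Rightarrow> ('a, 'b, 'm) module_scheme \<Rightarrow> ('a, 'c, 'n) module_scheme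
      \<Rightarrow> ('a, 'b \<Rightarrow> 'c) module" where
  "Hom_module R M N =
     \<lparr>carrier = module_hom R M N \<inter> extensional (carrier M),
      mult = (\<lambda>f g. \<lambda>x\<in>carrier M. \<zero>\<^bsub>N\<^esub>), one = (\<lambda>x\<in>carrier M. \<zero>\<^bsub>N\<^esub>),
      zero = (\<lambda>x\<in>carrier M. \<zero>\<^bsub>N\<^esub>),
      add = (\<lambda>f g. \<lambda>x\<in>carrier M. f x \<oplus>\<^bsub>N\<^esub> g x),
      smult = (\<lambda>r f. \<lambda>x\<in>carrier M. r \<odot>\<^bsub>N\<^esub> f x)\<rparr>"

definition restrict_scalars :: "('k \<Rightarrow> 'a) \<Rightarrow> ('a, 'b, 'm) module_scheme \<Rightarrow> ('k, 'b) module" where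
  "restrict_scalars h M =
     \<lparr>carrier = carrier M, mult = mult M, one = one M, zero = zero M, add = add M,
      smult = (\<lambda>c x. h c \<odot>\<^bsub>M\<^esub> x)\<rparr>"

text \<open>
  A polynomial is a finitely supported function from exponent vectors to coefficients. The ring
  in the variables \<open>x\<^sub>v\<close>, \<open>v \<in> V\<close>, is the subring of polynomials involving no other variable.
\<close>

type_synonym ('v, 'k) mpoly = "('v \<Rightarrow>\<^sub>0 nat) \<Rightarrow>\<^sub>0 'k"

definition Const :: "'k::field \<Rightarrow> ('v, 'k) mpoly" where
  "Const c = Poly_Mapping.single 0 c"

definition Var :: "'v \<Rightarrow> ('v, 'k::field) mpoly" where
  "Var v = Poly_Mapping.single (Poly_Mapping.single v 1) 1"

definition mpoly_ring :: "'v set \<Rightarrow> ('v, 'k::field) mpoly ring" where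
  "mpoly_ring V = class_ring\<lparr>carrier := {p. \<forall>m\<in>Poly_Mapping.keys p. Poly_Mapping.keys m \<subseteq> V}\<rparr>"

definition SR_ideal :: "'v set \<Rightarrow> 'v set set \<Rightarrow> ('v, 'k::field) mpoly set" where
  "SR_ideal V \<Delta> = Idl\<^bsub>mpoly_ring V\<^esub> {\<Prod>v\<in>N. Var v | N. N \<subseteq> V \<and> N \<notin> \<Delta>}"

definition SR_ring :: "'v set \<Rightarrow> 'v set set \<Rightarrow> ('v, 'k::field) mpoly set ring" where
  "SR_ring V \<Delta> = mpoly_ring V Quot SR_ideal V \<Delta>"

definition SR_ideal_module ::
    "'v set \<Rightarrow> 'v set set \<Rightarrow> (('v, 'k::field) mpoly, ('v, 'k) mpoly) module" where
  "SR_ideal_module V \<Delta> =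
     \<lparr>carrier = SR_ideal V \<Delta>, mult = (*), one = 1, zero = 0, add = (+), smult = (*)\<rparr>"

definition SR_ring_module ::
    "'v set \<Rightarrow> 'v set set \<Rightarrow> (('v, 'k::field) mpoly, ('v, 'k) mpoly set) module" where
  "SR_ring_module V \<Delta> =
     ring.extend (SR_ring V \<Delta>)
       (module.fields (\<lambda>s X. (SR_ideal V \<Delta> +>\<^bsub>mpoly_ring V\<^esub> s) \<otimes>\<^bsub>SR_ring V \<Delta>\<^esub> X))"

definition derivations :: "'v set \<Rightarrow> (('v, 'k::field) mpoly \<Rightarrow> ('v, 'k) mpoly) set" where
  "derivations V =
     {d \<in> carrier (mpoly_ring V) \<rightarrow> carrier (mpoly_ring V).
        (\<forall>f\<in>carrier (mpoly_ring V). \<forall>g\<in>carrier (mpoly_ring V).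
            d (f + g) = d f + d g \<and> d (f * g) = f * d g + g * d f) \<and>
        (\<forall>c. \<forall>f\<in>carrier (mpoly_ring V). d (Const c * f) = Const c * d f)}"

definition SR_Hom ::
    "'v set \<Rightarrow> 'v set set \<Rightarrow>
      (('v, 'k::field) mpoly, ('v, 'k) mpoly \<Rightarrow> ('v, 'k) mpoly set) module" where
  "SR_Hom V \<Delta> = Hom_module (mpoly_ring V) (SR_ideal_module V \<Delta>) (SR_ring_module V \<Delta>)"

definition delta_star ::
    "'v set \<Rightarrow> 'v set set \<Rightarrow> (('v, 'k::field) mpoly \<Rightarrow> ('v, 'k) mpoly)
      \<Rightarrow> ('v, 'k) mpoly \<Rightarrow> ('v, 'k) mpoly set" where
  "delta_star V \<Delta> d = (\<lambda>f\<in>SR_ideal V \<Delta>. SR_ideal V \<Delta> +>\<^bsub>mpoly_ring V\<^esub> d f)"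

text \<open>
  The cokernel of \<open>delta_star\<close>, viewed as a vector space over the coefficient field. The image
  of \<open>delta_star\<close> is a submodule over the polynomial ring.
\<close>

definition T1 ::
    "'v set \<Rightarrow> 'v set set \<Rightarrow>
      ('k::field, (('v, 'k) mpoly \<Rightarrow> ('v, 'k) mpoly set) set) module" where
  "T1 V \<Delta> =
     restrict_scalars Const (quot_module (SR_Hom V \<Delta>) (delta_star V \<Delta> ` derivations V))"

definition rigid :: "'k::field itself \<Rightarrow> 'v set \<Rightarrow> 'v set set \<Rightarrow> bool" where
  "rigid K V \<Delta> \<longleftrightarrow>
     zero_module (T1 V \<Delta> :: ('k, (('v, 'k) mpoly \<Rightarrow> ('v, 'k) mpoly set) set) module)"

text \<open>
  A degree in \<open>\<int>\<^sup>V\<close> is represented by a function on the whole type, of which only the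
  values on \<open>V\<close> matter. The component of degree \<open>d\<close> of the polynomial ring is zero if \<open>d\<close> has a
  negative entry on \<open>V\<close>.
\<close>

definition mpoly_component :: "'v set \<Rightarrow> ('v \<Rightarrow> int) \<Rightarrow> ('v, 'k::field) mpoly set" where
  "mpoly_component V d =
     {p \<in> carrier (mpoly_ring V). \<forall>m\<in>Poly_Mapping.keys p. \<forall>v\<in>V. int (Poly_Mapping.lookup m v) = d v}"

definition SR_component :: "'v set \<Rightarrow> 'v set set \<Rightarrow> ('v \<Rightarrow> int) \<Rightarrow> ('v, 'k::field) mpoly set set" where
  "SR_component V \<Delta> d = (\<lambda>p. SR_ideal V \<Delta> +>\<^bsub>mpoly_ring V\<^esub> p) ` mpoly_component V d"

definition SR_Hom_component ::
    "'v set \<Rightarrow> 'v set set \<Rightarrow> ('v \<Rightarrow> int) \<Rightarrow> (('v, 'k::field) mpoly \<Rightarrow> ('v, 'k) mpoly set) set" where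
  "SR_Hom_component V \<Delta> c =
     {\<phi> \<in> carrier (SR_Hom V \<Delta>).
        \<forall>d. \<forall>f \<in> SR_ideal V \<Delta> \<inter> mpoly_component V d. \<phi> f \<in> SR_component V \<Delta> (\<lambda>v. d v + c v)}"

text \<open>The classes in \<open>T1 V \<Delta>\<close> that have a homogeneous representative of degree \<open>c\<close>.\<close>

definition T1_component ::
    "'v set \<Rightarrow> 'v set set \<Rightarrow> ('v \<Rightarrow> int) \<Rightarrow>
      ('k::field, (('v, 'k) mpoly \<Rightarrow> ('v, 'k) mpoly set) set) module" where
  "T1_component V \<Delta> c =
     (T1 V \<Delta>)\<lparr>carrier :=
       (\<lambda>\<phi>. (delta_star V \<Delta> ` derivations V) +>\<^bsub>SR_Hom V \<Delta>\<^esub> \<phi>) ` SR_Hom_component V \<Delta> c\<rparr>"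

end

theory Submission
  imports Defs
begin

text \<open>
  A homomorphism of degree \<open>c\<close> sends each monomial \<open>x\<^sup>m\<close> of the Stanley--Reisner ideal to a scalar
  multiple \<open>l m\<close> of \<open>x\<^sup>m\<^sup>+\<^sup>c\<close>, and linearity over the polynomial ring says that \<open>l\<close> is constant along
  multiplication by monomials as long as \<open>x\<^sup>m\<^sup>+\<^sup>c\<close> does not vanish in the Stanley--Reisner ring. Those
  \<open>l\<close> that come from derivations are the linear forms in \<open>m\<close> whose \<open>w\<close>th coefficient may be nonzero
  only if \<open>c + e\<^sub>w \<ge> 0\<close>. So each graded component of \<open>T\<^sup>1\<close> is a quotient of spaces of functions on
  exponent vectors.

  Let \<open>c\<close> be a degree for the join. The support of \<open>m\<close> is a nonface on one of the two sides, say the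
  first, and then \<open>l m\<close> equals \<open>l\<close> at the restriction of \<open>m\<close> to \<open>E1\<close>. If \<open>c\<close> has a negative entry on
  each side, this value is zero. If \<open>c\<close> is nonnegative on \<open>E2\<close> with support a face there, restriction
  to \<open>E1\<close> identifies the function spaces of the join with those of the first complex. In the
  remaining degrees the positive part of \<open>c\<close> is a nonface and there is nothing to map to. Since the
  ideal is finitely generated, a homomorphism has only finitely many nonzero components, so rigidity
  can be tested degree by degree.
\<close>

section \<open>Polynomials and monomials\<close>

abbreviation mon :: "('v \<Rightarrow>\<^sub>0 nat) \<Rightarrow> ('v, 'k::field) mpoly" where
  "mon m \<equiv> Poly_Mapping.single m 1"

definition lin_ext :: "(('v \<Rightarrow>\<^sub>0 nat) \<Rightarrow> ('v, 'k::field) mpoly) \<Rightarrow> ('v, 'k) mpoly \<Rightarrow> ('v, 'k) mpoly" where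
  "lin_ext g p = (\<Sum>m\<in>Poly_Mapping.keys p. Const (Poly_Mapping.lookup p m) * g m)"

lemma Const_0 [simp]: "Const 0 = 0"
  and Const_1 [simp]: "Const 1 = 1"
  and Const_add: "Const (a + b) = Const a + Const b"
  and Const_mult: "Const (a * b) = Const a * Const b"
  by (simp_all add: Const_def single_add mult_single)

lemma lookup_Const_mult [simp]: "Poly_Mapping.lookup (Const c * p) m = c * Poly_Mapping.lookup p m"
proof -
  have "Const c * p = Poly_Mapping.map ((*) c) p"
    by (simp add: Const_def mult_map_scale_conv_mult)
  then show ?thesis by (simp add: Poly_Mapping.map.rep_eq when_def)
qed

lemma lookup_mon_mult_add [simp]: "Poly_Mapping.lookup (mon u * p) (u + m) = Poly_Mapping.lookup p m"
  for u m :: "'v \<Rightarrow>\<^sub>0 nat" and p :: "('v, 'k::field) mpoly"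
proof -
  have "Poly_Mapping.lookup (mon u * p) (u + m) =
     Sum_any (\<lambda>l. (1 when u = l) * Sum_any (\<lambda>q. Poly_Mapping.lookup p q when u + m = l + q))"
    by (simp add: lookup_mult lookup_single)
  also have "\<dots> = Sum_any (\<lambda>l. Sum_any (\<lambda>q. Poly_Mapping.lookup p q when u + m = l + q) when u = l)"
    by (simp add: when_mult)
  also have "\<dots> = Poly_Mapping.lookup p m" by simp
  finally show ?thesis .
qed

lemma lookup_mon_mult:
  "Poly_Mapping.lookup (mon u * p) n \<noteq> 0 \<Longrightarrow> \<exists>q. n = u + q"
  for u n :: "'v \<Rightarrow>\<^sub>0 nat" and p :: "('v, 'k::field) mpoly"
proof -
  assume "Poly_Mapping.lookup (mon u * p) n \<noteq> 0"
  then have "n \<in> Poly_Mapping.keys (mon u * p)" by (simp add: in_keys_iff)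
  then show ?thesis using keys_mult[of "mon u" p] by auto
qed

lemma keys_nat_add: "Poly_Mapping.keys (m + n) = Poly_Mapping.keys m \<union> Poly_Mapping.keys n"
  for m n :: "'v \<Rightarrow>\<^sub>0 nat"
  by (auto simp: in_keys_iff lookup_add)

lemma mpoly_expand: "p = (\<Sum>m\<in>Poly_Mapping.keys p. Const (Poly_Mapping.lookup p m) * mon m)"
proof (rule poly_mapping_eqI)
  fix k
  show "Poly_Mapping.lookup p k = Poly_Mapping.lookup (\<Sum>m\<in>Poly_Mapping.keys p. Const (Poly_Mapping.lookup p m) * mon m) k"
    by (simp add: lookup_sum lookup_single when_def in_keys_iff if_distrib cong: if_cong)
qed

lemma lin_ext_add: "lin_ext g (p + q) = lin_ext g p + lin_ext g q"
  unfolding lin_ext_def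
  by (rule setsum_keys_plus_distrib) (auto simp: Const_add algebra_simps)

lemma lin_ext_Const: "lin_ext g (Const c * p) = Const c * lin_ext g p"
proof -
  have "lin_ext g (Const c * p) = (\<Sum>m\<in>Poly_Mapping.keys p. Const (Poly_Mapping.lookup (Const c * p) m) * g m)"
    unfolding lin_ext_def by (rule sum.mono_neutral_left) (auto simp: in_keys_iff)
  also have "\<dots> = Const c * lin_ext g p"
    by (simp add: lin_ext_def sum_distrib_left Const_mult mult.assoc)
  finally show ?thesis .
qed

lemma lin_ext_mon [simp]: "lin_ext g (mon m) = g m"
  by (simp add: lin_ext_def)

lemma lin_ext_sum: "lin_ext g (sum f A) = (\<Sum>x\<in>A. lin_ext g (f x))"
  by (induction A rule: infinite_finite_induct) (auto simp: lin_ext_add lin_ext_def[of _ 0])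

definition polys :: "'v set \<Rightarrow> ('v, 'k::field) mpoly set" where
  "polys V = {p. \<forall>m\<in>Poly_Mapping.keys p. Poly_Mapping.keys m \<subseteq> V}"

lemma mpoly_ring_simps [simp]:
  "carrier (mpoly_ring V :: ('v, 'k::field) mpoly ring) = polys V"
  "\<zero>\<^bsub>mpoly_ring V :: ('v, 'k::field) mpoly ring\<^esub> = 0"
  "\<one>\<^bsub>mpoly_ring V :: ('v, 'k::field) mpoly ring\<^esub> = 1"
  "add (mpoly_ring V :: ('v, 'k::field) mpoly ring) = (+)"
  "mult (mpoly_ring V :: ('v, 'k::field) mpoly ring) = (*)"
  by (simp_all add: mpoly_ring_def polys_def)

lemma polysD: "p \<in> polys V \<Longrightarrow> m \<in> Poly_Mapping.keys p \<Longrightarrow> Poly_Mapping.keys m \<subseteq> V"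
  by (auto simp: polys_def)

lemma polys_0 [simp]: "0 \<in> polys V"
  and polys_1 [simp]: "1 \<in> polys V"
  by (auto simp: polys_def in_keys_iff lookup_one when_def split: if_splits)

lemma polys_add [simp]: "p \<in> polys V \<Longrightarrow> q \<in> polys V \<Longrightarrow> p + q \<in> polys V"
  unfolding polys_def using keys_add[of p q] by blast

lemma polys_mult [simp]: "p \<in> polys V \<Longrightarrow> q \<in> polys V \<Longrightarrow> p * q \<in> polys V"
  unfolding polys_def using keys_mult[of p q] by (fastforce simp: keys_nat_add)

lemma polys_uminus [simp]: "p \<in> polys V \<Longrightarrow> - p \<in> polys V"
  by (auto simp: polys_def in_keys_iff)

lemma polys_minus [simp]: "p \<in> polys V \<Longrightarrow> q \<in> polys V \<Longrightarrow> p - q \<in> polys V"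
  using polys_add[of p V "- q"] polys_uminus[of q V] by simp

lemma polys_Const [simp]: "Const c \<in> polys V"
  by (auto simp: polys_def Const_def in_keys_iff lookup_single when_def split: if_splits)

lemma polys_mon [simp]: "mon m \<in> polys V \<longleftrightarrow> Poly_Mapping.keys m \<subseteq> V"
  by (auto simp: polys_def)

lemma polys_sum: "(\<And>x. x \<in> A \<Longrightarrow> f x \<in> polys V) \<Longrightarrow> sum f A \<in> polys V"
  by (induction A rule: infinite_finite_induct) auto

lemma cring_mpoly_ring: "cring (mpoly_ring V :: ('v, 'k::field) mpoly ring)"
proof (rule cringI)
  show "abelian_group (mpoly_ring V :: ('v, 'k::field) mpoly ring)"
  proof (rule abelian_groupI)
    fix x :: "('v, 'k) mpoly" assume "x \<in> carrier (mpoly_ring V)"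
    then show "\<exists>y\<in>carrier (mpoly_ring V). y \<oplus>\<^bsub>mpoly_ring V\<^esub> x = \<zero>\<^bsub>mpoly_ring V\<^esub>"
      by (intro bexI[of _ "- x"]) auto
  qed (auto simp: algebra_simps)
  show "Group.comm_monoid (mpoly_ring V :: ('v, 'k::field) mpoly ring)"
    by (rule comm_monoidI) (auto simp: algebra_simps)
qed (auto simp: algebra_simps)

lemma coset_mpoly_ring: "I +>\<^bsub>mpoly_ring V\<^esub> p = {i + p | i. i \<in> I}"
  by (auto simp: a_r_coset_def')

lemma prod_Var: "finite N \<Longrightarrow> (\<Prod>v\<in>N. Var v) = (mon (\<Sum>v\<in>N. Poly_Mapping.single v 1) :: ('v, 'k::field) mpoly)"
  by (induction N rule: finite_induct) (auto simp: Var_def mult_single)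

lemma lookup_squarefree:
  "finite N \<Longrightarrow> Poly_Mapping.lookup (\<Sum>v\<in>N. Poly_Mapping.single v (1::nat)) w = (if w \<in> N then 1 else 0)"
  by (simp add: lookup_sum lookup_single when_def)

lemma keys_squarefree: "finite N \<Longrightarrow> Poly_Mapping.keys (\<Sum>v\<in>N. Poly_Mapping.single v (1::nat)) = N"
  by (auto simp: in_keys_iff lookup_squarefree simp del: One_nat_def split: if_splits)

lemma image_eq_singleton_iff: "A \<noteq> {} \<Longrightarrow> f ` A = {b} \<longleftrightarrow> (\<forall>x\<in>A. f x = b)"
  by auto

lemma squarefree_decomp:
  fixes m :: "'v \<Rightarrow>\<^sub>0 nat"
  shows "m = (m - (\<Sum>v\<in>Poly_Mapping.keys m. Poly_Mapping.single v 1)) + (\<Sum>v\<in>Poly_Mapping.keys m. Poly_Mapping.single v 1)"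
  by (rule poly_mapping_eqI) (auto simp: lookup_add lookup_minus lookup_squarefree in_keys_iff simp del: One_nat_def)

section \<open>Homomorphisms on the Stanley--Reisner ideal\<close>

locale complex =
  fixes V :: "'v set" and \<Delta> :: "'v set set"
  assumes complex: "simplicial_complex V \<Delta>"
begin

lemma finite_V: "finite V"
  and faces_subset: "F \<in> \<Delta> \<Longrightarrow> F \<subseteq> V"
  and empty_face: "{} \<in> \<Delta>"
  and face_mono: "F \<in> \<Delta> \<Longrightarrow> G \<subseteq> F \<Longrightarrow> G \<in> \<Delta>"
  using complex by (auto simp: simplicial_complex_def)

lemma SR_ideal_eq:
  "(SR_ideal V \<Delta> :: ('v, 'k::field) mpoly set) = {p \<in> polys V. \<forall>m\<in>Poly_Mapping.keys p. Poly_Mapping.keys m \<notin> \<Delta>}" (is "_ = ?J")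
proof -
  let ?R = "mpoly_ring V :: ('v, 'k) mpoly ring"
  let ?G = "{\<Prod>v\<in>N. Var v | N. N \<subseteq> V \<and> N \<notin> \<Delta>} :: ('v, 'k) mpoly set"
  interpret cring ?R by (rule cring_mpoly_ring)
  have minv: "\<ominus>\<^bsub>?R\<^esub> x = - x" if "x \<in> polys V" for x
    using that minus_equality[of "-x" x] by simp
  have gen: "(\<Prod>v\<in>N. Var v) \<in> ?J" if "N \<subseteq> V" "N \<notin> \<Delta>" for N
  proof -
    have "finite N" using that finite_V finite_subset by blast
    then show ?thesis using that
      by (auto simp: prod_Var keys_squarefree simp del: One_nat_def)
  qed
  have "ideal ?J ?R"
  proof (rule idealI)
    show "ring ?R" by (rule ring_axioms)
    show "subgroup ?J (add_monoid ?R)"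
    proof (rule subgroup.intro)
      fix x y assume "x \<in> ?J" "y \<in> ?J"
      then show "x \<otimes>\<^bsub>add_monoid ?R\<^esub> y \<in> ?J" using keys_add[of x y] by auto
    next
      fix x assume x: "x \<in> ?J"
      have "inv\<^bsub>add_monoid ?R\<^esub> x = - x" using minv[of x] x by (simp add: a_inv_def)
      then show "inv\<^bsub>add_monoid ?R\<^esub> x \<in> ?J" using x by (auto simp: in_keys_iff)
    qed auto
  next
    fix a x assume *: "a \<in> ?J" "x \<in> carrier ?R"
    then have "x * a \<in> ?J" using keys_mult[of x a]
      by (auto simp: keys_nat_add dest!: subsetD) (metis face_mono sup_ge2)
    then show "x \<otimes>\<^bsub>?R\<^esub> a \<in> ?J" "a \<otimes>\<^bsub>?R\<^esub> x \<in> ?J" by (auto simp: mult.commute)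
  qed
  then have 1: "SR_ideal V \<Delta> \<subseteq> ?J"
    unfolding SR_ideal_def by (rule genideal_minimal) (use gen in auto)
  have I: "ideal (SR_ideal V \<Delta>) ?R"
    unfolding SR_ideal_def by (rule genideal_ideal) (use gen in auto)
  have "?G \<subseteq> carrier ?R" using gen by auto
  then have G_subset: "?G \<subseteq> SR_ideal V \<Delta>"
    unfolding SR_ideal_def by (rule genideal_self)
  have "?J \<subseteq> SR_ideal V \<Delta>"
  proof
    fix p :: "('v, 'k) mpoly" assume p: "p \<in> ?J"
    interpret I: ideal "SR_ideal V \<Delta>" ?R by (rule I)
    have "Const (Poly_Mapping.lookup p m) * mon m \<in> SR_ideal V \<Delta>" if m: "m \<in> Poly_Mapping.keys p" for m
    proof -
      let ?s = "\<Sum>v\<in>Poly_Mapping.keys m. Poly_Mapping.single v (1::nat)"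
      have mV: "Poly_Mapping.keys m \<subseteq> V" "Poly_Mapping.keys m \<notin> \<Delta>" using p m by (auto dest: polysD)
      have "mon ?s \<in> ?G" using mV by (auto intro!: exI[of _ "Poly_Mapping.keys m"] simp: prod_Var)
      then have s: "(mon ?s :: ('v, 'k) mpoly) \<in> SR_ideal V \<Delta>" by (rule subsetD[OF G_subset])
      have "Poly_Mapping.keys (m - ?s) \<subseteq> V" using mV by (auto simp: in_keys_iff lookup_minus)
      then have "Const (Poly_Mapping.lookup p m) * mon (m - ?s) \<in> carrier ?R" by simp
      from I.I_l_closed[OF s this]
      have "(Const (Poly_Mapping.lookup p m) * mon (m - ?s)) * mon ?s \<in> SR_ideal V \<Delta>" by simp
      moreover have "mon (m - ?s) * mon ?s = (mon m :: ('v, 'k) mpoly)"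
        unfolding mult_single using squarefree_decomp[of m] by simp
      ultimately show ?thesis by (simp add: mult.assoc)
    qed
    note terms = this
    have sums: "sum f A \<in> SR_ideal V \<Delta>" if "\<And>x. x \<in> A \<Longrightarrow> f x \<in> SR_ideal V \<Delta>"
        for A :: "('v \<Rightarrow>\<^sub>0 nat) set" and f :: "_ \<Rightarrow> ('v, 'k) mpoly"
      using that by (induction A rule: infinite_finite_induct)
        (use I.a_closed I.zero_closed in auto)
    show "p \<in> SR_ideal V \<Delta>"
      by (subst mpoly_expand, rule sums, rule terms)
  qed
  with 1 show ?thesis by blast
qed

abbreviation coset :: "('v, 'k::field) mpoly \<Rightarrow> ('v, 'k) mpoly set" where
  "coset p \<equiv> SR_ideal V \<Delta> +>\<^bsub>mpoly_ring V\<^esub> p"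

lemma ideal_SR_ideal: "ideal (SR_ideal V \<Delta>) (mpoly_ring V :: ('v, 'k::field) mpoly ring)"
proof -
  interpret cring "mpoly_ring V :: ('v, 'k) mpoly ring" by (rule cring_mpoly_ring)
  have "(\<Prod>v\<in>N. Var v) \<in> (polys V :: ('v, 'k) mpoly set)" if "N \<subseteq> V" for N
  proof -
    have "finite N" using that finite_V finite_subset by blast
    then show ?thesis using that by (simp add: prod_Var keys_squarefree del: One_nat_def)
  qed
  then show ?thesis
    unfolding SR_ideal_def by (intro genideal_ideal) auto
qed

lemma SR_ideal_iff: "p \<in> SR_ideal V \<Delta> \<longleftrightarrow> p \<in> polys V \<and> (\<forall>m. Poly_Mapping.keys m \<in> \<Delta> \<longrightarrow> Poly_Mapping.lookup p m = 0)"
  unfolding SR_ideal_eq by (auto simp: in_keys_iff)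

lemma SR_ideal_polys: "p \<in> SR_ideal V \<Delta> \<Longrightarrow> p \<in> polys V"
  by (simp add: SR_ideal_iff)

lemma SR_ideal_add [simp]: "p \<in> SR_ideal V \<Delta> \<Longrightarrow> q \<in> SR_ideal V \<Delta> \<Longrightarrow> p + q \<in> SR_ideal V \<Delta>"
  and SR_ideal_0 [simp]: "0 \<in> SR_ideal V \<Delta>"
  by (simp_all add: SR_ideal_iff lookup_add)

lemma SR_ideal_mult [simp]: "p \<in> SR_ideal V \<Delta> \<Longrightarrow> r \<in> polys V \<Longrightarrow> r * p \<in> SR_ideal V \<Delta>"
  using ideal.I_l_closed[OF ideal_SR_ideal, of p r] by simp

lemma SR_ideal_mon [simp]: "mon m \<in> SR_ideal V \<Delta> \<longleftrightarrow> Poly_Mapping.keys m \<subseteq> V \<and> Poly_Mapping.keys m \<notin> \<Delta>"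
  by (auto simp: SR_ideal_eq)

lemma SR_ideal_sum: "(\<And>x. x \<in> A \<Longrightarrow> f x \<in> SR_ideal V \<Delta>) \<Longrightarrow> sum f A \<in> SR_ideal V \<Delta>"
  by (induction A rule: infinite_finite_induct) auto

lemma coset_eq_iff:
  assumes "p \<in> polys V" "q \<in> polys V"
  shows "coset p = coset q \<longleftrightarrow> (\<forall>n. Poly_Mapping.keys n \<in> \<Delta> \<longrightarrow> Poly_Mapping.lookup p n = Poly_Mapping.lookup q n)"
    (is "_ \<longleftrightarrow> ?r")
proof
  assume "coset p = coset q"
  then have "0 + p \<in> coset q" unfolding coset_mpoly_ring using SR_ideal_0 by blast
  then obtain i where "i \<in> SR_ideal V \<Delta>" "p = i + q" by (auto simp: coset_mpoly_ring)
  then show ?r by (simp add: SR_ideal_iff lookup_add)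
next
  assume ?r
  then have "p - q \<in> SR_ideal V \<Delta>" "q - p \<in> SR_ideal V \<Delta>"
    using assms by (simp_all add: SR_ideal_iff lookup_minus)
  then have *: "i + (p - q) \<in> SR_ideal V \<Delta>" "i + (q - p) \<in> SR_ideal V \<Delta>"
    if "i \<in> SR_ideal V \<Delta>" for i using that SR_ideal_add by blast+
  have "\<exists>j. i + p = j + q \<and> j \<in> SR_ideal V \<Delta>" "\<exists>j. i + q = j + p \<and> j \<in> SR_ideal V \<Delta>"
    if "i \<in> SR_ideal V \<Delta>" for i
    using *[OF that] by (intro exI[of _ "i + (p - q)"] exI[of _ "i + (q - p)"]; simp)+
  then show "coset p = coset q"
    unfolding coset_mpoly_ring by blast
qed

lemma SR_ring_module_simps [simp]:
  "carrier (SR_ring_module V \<Delta>) = coset ` (polys V :: ('v, 'k::field) mpoly set)"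
  "\<zero>\<^bsub>SR_ring_module V \<Delta>\<^esub> = (SR_ideal V \<Delta> :: ('v, 'k::field) mpoly set)"
  "add (SR_ring_module V \<Delta> :: (('v, 'k::field) mpoly, ('v, 'k) mpoly set) module) = set_add (mpoly_ring V)"
  by (auto simp: SR_ring_module_def SR_ring_def ring.defs module.defs FactRing_def A_RCOSETS_def'
      simp del: SR_ideal_mon)

lemma coset_add [simp]:
  "p \<in> polys V \<Longrightarrow> q \<in> polys V \<Longrightarrow> coset p <+>\<^bsub>mpoly_ring V\<^esub> coset q = coset (p + q)"
proof -
  interpret ideal "SR_ideal V \<Delta>" "mpoly_ring V :: ('v, 'a) mpoly ring" by (rule ideal_SR_ideal)
  assume "p \<in> polys V" "q \<in> polys V"
  then show ?thesis using a_rcos_sum[of p q] by simp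
qed

lemma coset_smult [simp]:
  "s \<in> polys V \<Longrightarrow> p \<in> polys V \<Longrightarrow> s \<odot>\<^bsub>SR_ring_module V \<Delta>\<^esub> coset p = coset (s * p)"
proof -
  interpret ideal "SR_ideal V \<Delta>" "mpoly_ring V :: ('v, 'a) mpoly ring" by (rule ideal_SR_ideal)
  assume "s \<in> polys V" "p \<in> polys V"
  then show ?thesis using rcoset_mult_add[of s p]
    by (simp add: SR_ring_module_def SR_ring_def ring.defs module.defs FactRing_def)
qed

lemma coset_0: "coset (0 :: ('v, 'k::field) mpoly) = SR_ideal V \<Delta>"
  by (auto simp: coset_mpoly_ring)

definition rep :: "(('v, 'k::field) mpoly \<Rightarrow> ('v, 'k) mpoly set) \<Rightarrow> ('v, 'k) mpoly \<Rightarrow> ('v, 'k) mpoly" where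
  "rep \<phi> f = (SOME p. p \<in> polys V \<and> \<phi> f = coset p)"

lemma SR_Hom_iff:
  "\<phi> \<in> carrier (SR_Hom V \<Delta>) \<longleftrightarrow>
     (\<forall>f\<in>SR_ideal V \<Delta>. \<phi> f \<in> coset ` polys V) \<and>
     (\<forall>f\<in>SR_ideal V \<Delta>. \<forall>g\<in>SR_ideal V \<Delta>. \<phi> (f + g) = \<phi> f <+>\<^bsub>mpoly_ring V\<^esub> \<phi> g) \<and>
     (\<forall>r\<in>polys V. \<forall>f\<in>SR_ideal V \<Delta>. \<phi> (r * f) = r \<odot>\<^bsub>SR_ring_module V \<Delta>\<^esub> \<phi> f) \<and>
     \<phi> \<in> extensional (SR_ideal V \<Delta>)"
  apply (simp only: SR_Hom_def Hom_module_def LinearCombinations.module_hom_def SR_ideal_module_def module.simps ring.simps partial_object.simps SR_ring_module_simps mpoly_ring_simps)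
  apply (unfold Pi_iff Int_iff mem_Collect_eq Ball_def)
  apply (intro iffI conjI)
  apply (elim conjE; assumption?; blast)+
  done

lemma SR_HomD:
  assumes "\<phi> \<in> carrier (SR_Hom V \<Delta>)"
  shows "f \<in> SR_ideal V \<Delta> \<Longrightarrow> \<phi> f \<in> coset ` polys V"
    and "f \<in> SR_ideal V \<Delta> \<Longrightarrow> g \<in> SR_ideal V \<Delta> \<Longrightarrow> \<phi> (f + g) = \<phi> f <+>\<^bsub>mpoly_ring V\<^esub> \<phi> g"
    and "r \<in> polys V \<Longrightarrow> f \<in> SR_ideal V \<Delta> \<Longrightarrow> \<phi> (r * f) = r \<odot>\<^bsub>SR_ring_module V \<Delta>\<^esub> \<phi> f"
    and "\<phi> \<in> extensional (SR_ideal V \<Delta>)"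
  using assms unfolding SR_Hom_iff by blast+

lemma rep_polys_of:
  assumes "\<phi> f \<in> coset ` polys V"
  shows "rep \<phi> f \<in> polys V" "\<phi> f = coset (rep \<phi> f)"
proof -
  have "\<exists>p. p \<in> polys V \<and> \<phi> f = coset p" using assms by auto
  from someI_ex[OF this] show "rep \<phi> f \<in> polys V" "\<phi> f = coset (rep \<phi> f)"
    unfolding rep_def by blast+
qed

lemma rep_polys:
  assumes "\<phi> \<in> carrier (SR_Hom V \<Delta>)" "f \<in> SR_ideal V \<Delta>"
  shows "rep \<phi> f \<in> polys V" "\<phi> f = coset (rep \<phi> f)"
  by (rule rep_polys_of[where \<phi> = \<phi> and f = f, OF SR_HomD(1)[OF assms]])+

lemma lookup_rep:
  assumes "\<phi> f = coset p" "p \<in> polys V" "Poly_Mapping.keys n \<in> \<Delta>"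
  shows "Poly_Mapping.lookup (rep \<phi> f) n = Poly_Mapping.lookup p n"
proof -
  have "\<phi> f \<in> coset ` polys V" using assms by blast
  from rep_polys_of[where \<phi> = \<phi> and f = f, OF this] assms show ?thesis using coset_eq_iff by metis
qed

lemma rep_add:
  assumes "\<phi> \<in> carrier (SR_Hom V \<Delta>)" "f \<in> SR_ideal V \<Delta>" "g \<in> SR_ideal V \<Delta>" "Poly_Mapping.keys n \<in> \<Delta>"
  shows "Poly_Mapping.lookup (rep \<phi> (f + g)) n = Poly_Mapping.lookup (rep \<phi> f) n + Poly_Mapping.lookup (rep \<phi> g) n"
proof -
  have "\<phi> (f + g) = \<phi> f <+>\<^bsub>mpoly_ring V\<^esub> \<phi> g" by (rule SR_HomD(2)[OF assms(1-3)])
  also have "\<dots> = coset (rep \<phi> f + rep \<phi> g)"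
    using rep_polys[OF assms(1)] assms by (metis coset_add)
  finally show ?thesis
    using lookup_rep[of \<phi> "f + g" "rep \<phi> f + rep \<phi> g" n] rep_polys(1)[OF assms(1)] assms
    by (simp add: lookup_add)
qed

lemma rep_mult:
  assumes "\<phi> \<in> carrier (SR_Hom V \<Delta>)" "f \<in> SR_ideal V \<Delta>" "r \<in> polys V" "Poly_Mapping.keys n \<in> \<Delta>"
  shows "Poly_Mapping.lookup (rep \<phi> (r * f)) n = Poly_Mapping.lookup (r * rep \<phi> f) n"
proof -
  have "\<phi> (r * f) = r \<odot>\<^bsub>SR_ring_module V \<Delta>\<^esub> \<phi> f" by (rule SR_HomD(3)[OF assms(1,3,2)])
  also have "\<dots> = coset (r * rep \<phi> f)"
    using rep_polys[OF assms(1)] assms by (metis coset_smult)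
  finally show ?thesis
    using lookup_rep[of \<phi> "r * f" "r * rep \<phi> f" n] rep_polys(1)[OF assms(1)] assms by simp
qed

lemma rep_0:
  assumes "\<phi> \<in> carrier (SR_Hom V \<Delta>)" "Poly_Mapping.keys n \<in> \<Delta>"
  shows "Poly_Mapping.lookup (rep \<phi> 0) n = 0"
  using rep_mult[OF assms(1) SR_ideal_0 polys_0 assms(2)] by simp

lemma rep_sum:
  assumes "\<phi> \<in> carrier (SR_Hom V \<Delta>)" "Poly_Mapping.keys n \<in> \<Delta>" "\<And>x. x \<in> A \<Longrightarrow> f x \<in> SR_ideal V \<Delta>"
  shows "Poly_Mapping.lookup (rep \<phi> (sum f A)) n = (\<Sum>x\<in>A. Poly_Mapping.lookup (rep \<phi> (f x)) n)"
  using assms(3)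
  by (induction A rule: infinite_finite_induct)
    (auto simp: rep_0[OF assms(1,2)] rep_add[OF assms(1)] SR_ideal_sum assms(2))

text \<open>
  Meaningful only if the support of \<open>n\<close> is a face: the other coefficients of a representative of a
  coset are arbitrary.
\<close>

definition hcoef :: "(('v, 'k::field) mpoly \<Rightarrow> ('v, 'k) mpoly set) \<Rightarrow> ('v \<Rightarrow>\<^sub>0 nat) \<Rightarrow> ('v \<Rightarrow>\<^sub>0 nat) \<Rightarrow> 'k" where
  "hcoef \<phi> m n = Poly_Mapping.lookup (rep \<phi> (mon m)) n"

lemma rep_expand:
  assumes "\<phi> \<in> carrier (SR_Hom V \<Delta>)" "f \<in> SR_ideal V \<Delta>" "Poly_Mapping.keys n \<in> \<Delta>"
  shows "Poly_Mapping.lookup (rep \<phi> f) n = (\<Sum>m\<in>Poly_Mapping.keys f. Poly_Mapping.lookup f m * hcoef \<phi> m n)"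
proof -
  have m: "mon m \<in> SR_ideal V \<Delta>" if "m \<in> Poly_Mapping.keys f" for m
    using assms(2) that by (auto simp: SR_ideal_eq dest: polysD)
  have "Poly_Mapping.lookup (rep \<phi> f) n = Poly_Mapping.lookup (rep \<phi> (\<Sum>m\<in>Poly_Mapping.keys f. Const (Poly_Mapping.lookup f m) * mon m)) n"
    by (simp only: mpoly_expand[symmetric])
  also have "\<dots> = (\<Sum>m\<in>Poly_Mapping.keys f. Poly_Mapping.lookup (rep \<phi> (Const (Poly_Mapping.lookup f m) * mon m)) n)"
    by (rule rep_sum[OF assms(1,3)]) (auto intro!: SR_ideal_mult m simp del: SR_ideal_mon)
  also have "\<dots> = (\<Sum>m\<in>Poly_Mapping.keys f. Poly_Mapping.lookup f m * hcoef \<phi> m n)"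
    by (rule sum.cong) (auto simp: rep_mult[OF assms(1) m _ assms(3)] hcoef_def simp del: SR_ideal_mon)
  finally show ?thesis .
qed

lemma SR_Hom_eqI:
  fixes \<phi> \<psi> :: "('v, 'k::field) mpoly \<Rightarrow> ('v, 'k) mpoly set"
  assumes "\<phi> \<in> carrier (SR_Hom V \<Delta>)" "\<psi> \<in> carrier (SR_Hom V \<Delta>)"
    and "\<And>m n. Poly_Mapping.keys m \<subseteq> V \<Longrightarrow> Poly_Mapping.keys m \<notin> \<Delta> \<Longrightarrow> Poly_Mapping.keys n \<in> \<Delta> \<Longrightarrow> hcoef \<phi> m n = hcoef \<psi> m n"
  shows "\<phi> = \<psi>"
proof (rule extensionalityI)
  show "\<phi> \<in> extensional (SR_ideal V \<Delta>)" "\<psi> \<in> extensional (SR_ideal V \<Delta>)"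
    using assms(1,2) by (auto intro: SR_HomD(4))
  fix f :: "('v, 'k) mpoly" assume f: "f \<in> SR_ideal V \<Delta>"
  have "Poly_Mapping.lookup (rep \<phi> f) n = Poly_Mapping.lookup (rep \<psi> f) n" if "Poly_Mapping.keys n \<in> \<Delta>" for n
    unfolding rep_expand[OF assms(1) f that] rep_expand[OF assms(2) f that]
    using f that by (intro sum.cong refl arg_cong2[of _ _ _ _ "(*)"] assms(3)) (auto simp: SR_ideal_eq dest: polysD)
  then show "\<phi> f = \<psi> f"
    using rep_polys[OF assms(1) f] rep_polys[OF assms(2) f] coset_eq_iff by metis
qed

lemma SR_HomI:
  assumes "\<And>f. f \<in> SR_ideal V \<Delta> \<Longrightarrow> g f \<in> polys V"
    and "\<And>f f' n. f \<in> SR_ideal V \<Delta> \<Longrightarrow> f' \<in> SR_ideal V \<Delta> \<Longrightarrow> Poly_Mapping.keys n \<in> \<Delta> \<Longrightarrow>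
        Poly_Mapping.lookup (g (f + f')) n = Poly_Mapping.lookup (g f + g f') n"
    and "\<And>f r n. f \<in> SR_ideal V \<Delta> \<Longrightarrow> r \<in> polys V \<Longrightarrow> Poly_Mapping.keys n \<in> \<Delta> \<Longrightarrow>
        Poly_Mapping.lookup (g (r * f)) n = Poly_Mapping.lookup (r * g f) n"
  shows "(\<lambda>f\<in>SR_ideal V \<Delta>. coset (g f)) \<in> carrier (SR_Hom V \<Delta>)"
  unfolding SR_Hom_iff using assms by (auto simp: coset_eq_iff)

lemma hcoef_coset:
  assumes "\<And>f. f \<in> SR_ideal V \<Delta> \<Longrightarrow> g f \<in> polys V"
    "Poly_Mapping.keys m \<subseteq> V" "Poly_Mapping.keys m \<notin> \<Delta>" "Poly_Mapping.keys n \<in> \<Delta>"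
  shows "hcoef (\<lambda>f\<in>SR_ideal V \<Delta>. coset (g f)) m n = Poly_Mapping.lookup (g (mon m)) n"
  unfolding hcoef_def by (rule lookup_rep) (use assms in auto)

end

lemma derivationsD:
  assumes "d \<in> derivations V"
  shows "f \<in> polys V \<Longrightarrow> d f \<in> polys V"
    and "f \<in> polys V \<Longrightarrow> g \<in> polys V \<Longrightarrow> d (f + g) = d f + d g"
    and "f \<in> polys V \<Longrightarrow> g \<in> polys V \<Longrightarrow> d (f * g) = f * d g + g * d f"
    and "f \<in> polys V \<Longrightarrow> d (Const c * f) = Const c * d f"
  using assms by (auto simp: derivations_def Pi_iff)

lemma derivations_add:
  assumes "d \<in> derivations V" "d' \<in> derivations V"
  shows "(\<lambda>f. d f + d' f) \<in> derivations V"
  using derivationsD[OF assms(1)] derivationsD[OF assms(2)]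
  by (simp add: derivations_def Pi_iff algebra_simps)

lemma derivations_scale:
  assumes "d \<in> derivations V"
  shows "(\<lambda>f. Const c * d f) \<in> derivations V"
  using derivationsD[OF assms]
  by (simp add: derivations_def Pi_iff algebra_simps)

lemma derivations_zero: "(\<lambda>f. 0) \<in> derivations V"
  by (simp add: derivations_def)

context complex
begin

subsection \<open>The module of homomorphisms and its quotient by derivations\<close>

lemma SR_Hom_add_eq:
  assumes "\<phi> \<in> carrier (SR_Hom V \<Delta>)" "\<psi> \<in> carrier (SR_Hom V \<Delta>)"
  shows "\<phi> \<oplus>\<^bsub>SR_Hom V \<Delta>\<^esub> \<psi> = (\<lambda>f\<in>SR_ideal V \<Delta>. coset (rep \<phi> f + rep \<psi> f))"
proof (rule extensionalityI)
  show "\<phi> \<oplus>\<^bsub>SR_Hom V \<Delta>\<^esub> \<psi> \<in> extensional (SR_ideal V \<Delta>)"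
    by (simp add: SR_Hom_def Hom_module_def SR_ideal_module_def)
  fix f :: "('v, 'a) mpoly" assume f: "f \<in> SR_ideal V \<Delta>"
  have "(\<phi> \<oplus>\<^bsub>SR_Hom V \<Delta>\<^esub> \<psi>) f = \<phi> f <+>\<^bsub>mpoly_ring V\<^esub> \<psi> f"
    using f by (simp add: SR_Hom_def Hom_module_def SR_ideal_module_def)
  also have "\<dots> = coset (rep \<phi> f + rep \<psi> f)"
    using rep_polys[OF assms(1) f] rep_polys[OF assms(2) f] by (metis coset_add)
  finally show "(\<phi> \<oplus>\<^bsub>SR_Hom V \<Delta>\<^esub> \<psi>) f = (\<lambda>f\<in>SR_ideal V \<Delta>. coset (rep \<phi> f + rep \<psi> f)) f"
    using f by simp
qed simp

lemma SR_Hom_add [simp]: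
  assumes "\<phi> \<in> carrier (SR_Hom V \<Delta>)" "\<psi> \<in> carrier (SR_Hom V \<Delta>)"
  shows "\<phi> \<oplus>\<^bsub>SR_Hom V \<Delta>\<^esub> \<psi> \<in> carrier (SR_Hom V \<Delta>)"
  unfolding SR_Hom_add_eq[OF assms]
  by (rule SR_HomI)
    (simp_all add: rep_polys[OF assms(1)] rep_polys[OF assms(2)] rep_add[OF assms(1)] rep_add[OF assms(2)]
      rep_mult[OF assms(1)] rep_mult[OF assms(2)] lookup_add distrib_left)

lemma hcoef_add:
  assumes "\<phi> \<in> carrier (SR_Hom V \<Delta>)" "\<psi> \<in> carrier (SR_Hom V \<Delta>)"
    "Poly_Mapping.keys m \<subseteq> V" "Poly_Mapping.keys m \<notin> \<Delta>" "Poly_Mapping.keys n \<in> \<Delta>"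
  shows "hcoef (\<phi> \<oplus>\<^bsub>SR_Hom V \<Delta>\<^esub> \<psi>) m n = hcoef \<phi> m n + hcoef \<psi> m n"
  unfolding SR_Hom_add_eq[OF assms(1,2)]
  by (subst hcoef_coset) (use rep_polys[OF assms(1)] rep_polys[OF assms(2)] assms in \<open>auto simp: lookup_add hcoef_def\<close>)

lemma SR_Hom_smult_eq:
  assumes "\<phi> \<in> carrier (SR_Hom V \<Delta>)"
  shows "Const c \<odot>\<^bsub>SR_Hom V \<Delta>\<^esub> \<phi> = (\<lambda>f\<in>SR_ideal V \<Delta>. coset (Const c * rep \<phi> f))"
proof (rule extensionalityI)
  show "Const c \<odot>\<^bsub>SR_Hom V \<Delta>\<^esub> \<phi> \<in> extensional (SR_ideal V \<Delta>)"
    by (simp add: SR_Hom_def Hom_module_def SR_ideal_module_def)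
  fix f :: "('v, 'a) mpoly" assume f: "f \<in> SR_ideal V \<Delta>"
  have "(Const c \<odot>\<^bsub>SR_Hom V \<Delta>\<^esub> \<phi>) f = Const c \<odot>\<^bsub>SR_ring_module V \<Delta>\<^esub> \<phi> f"
    using f by (simp add: SR_Hom_def Hom_module_def SR_ideal_module_def)
  also have "\<dots> = coset (Const c * rep \<phi> f)"
    using rep_polys[OF assms f] by (metis coset_smult polys_Const)
  finally show "(Const c \<odot>\<^bsub>SR_Hom V \<Delta>\<^esub> \<phi>) f = (\<lambda>f\<in>SR_ideal V \<Delta>. coset (Const c * rep \<phi> f)) f"
    using f by simp
qed simp

lemma SR_Hom_smult [simp]:
  assumes "\<phi> \<in> carrier (SR_Hom V \<Delta>)"
  shows "Const c \<odot>\<^bsub>SR_Hom V \<Delta>\<^esub> \<phi> \<in> carrier (SR_Hom V \<Delta>)"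
  unfolding SR_Hom_smult_eq[OF assms]
proof (rule SR_HomI)
  fix f r :: "('v, 'a) mpoly" and n :: "'v \<Rightarrow>\<^sub>0 nat" assume *: "f \<in> SR_ideal V \<Delta>" "r \<in> polys V" "Poly_Mapping.keys n \<in> \<Delta>"
  have "r * (Const c * rep \<phi> f) = Const c * (r * rep \<phi> f)" by (simp add: algebra_simps)
  then have "Poly_Mapping.lookup (r * (Const c * rep \<phi> f)) n = c * Poly_Mapping.lookup (r * rep \<phi> f) n"
    by (simp only: lookup_Const_mult)
  with * show "Poly_Mapping.lookup (Const c * rep \<phi> (r * f)) n = Poly_Mapping.lookup (r * (Const c * rep \<phi> f)) n"
    by (simp add: rep_mult[OF assms])
qed (simp_all add: rep_polys[OF assms] rep_add[OF assms] lookup_add distrib_left)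

lemma hcoef_smult:
  assumes "\<phi> \<in> carrier (SR_Hom V \<Delta>)"
    "Poly_Mapping.keys m \<subseteq> V" "Poly_Mapping.keys m \<notin> \<Delta>" "Poly_Mapping.keys n \<in> \<Delta>"
  shows "hcoef (Const c \<odot>\<^bsub>SR_Hom V \<Delta>\<^esub> \<phi>) m n = c * hcoef \<phi> m n"
  unfolding SR_Hom_smult_eq[OF assms(1)]
  by (subst hcoef_coset) (use rep_polys[OF assms(1)] assms in \<open>auto simp: hcoef_def\<close>)

lemma SR_Hom_zero_eq: "\<zero>\<^bsub>SR_Hom V \<Delta>\<^esub> = (\<lambda>f\<in>SR_ideal V \<Delta>. coset (0 :: ('v, 'k::field) mpoly))"
  by (simp add: SR_Hom_def Hom_module_def SR_ideal_module_def coset_0)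

lemma SR_Hom_zero [simp]:
  "\<zero>\<^bsub>SR_Hom V \<Delta> :: (('v, 'k::field) mpoly, _) module\<^esub> \<in> carrier (SR_Hom V \<Delta>)"
  unfolding SR_Hom_zero_eq by (rule SR_HomI) simp_all

lemma hcoef_zero:
  assumes "Poly_Mapping.keys m \<subseteq> V" "Poly_Mapping.keys m \<notin> \<Delta>" "Poly_Mapping.keys n \<in> \<Delta>"
  shows "hcoef (\<zero>\<^bsub>SR_Hom V \<Delta>\<^esub>) m n = (0 :: 'k::field)"
  unfolding SR_Hom_zero_eq by (subst hcoef_coset) (use assms in auto)

lemma SR_Hom_neg:
  fixes \<phi> :: "('v, 'k::field) mpoly \<Rightarrow> ('v, 'k) mpoly set"
  assumes "\<phi> \<in> carrier (SR_Hom V \<Delta>)"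
  shows "(Const (-1) \<odot>\<^bsub>SR_Hom V \<Delta>\<^esub> \<phi>) \<oplus>\<^bsub>SR_Hom V \<Delta>\<^esub> \<phi> = \<zero>\<^bsub>SR_Hom V \<Delta>\<^esub>"
  by (rule SR_Hom_eqI) (use assms in \<open>simp_all add: hcoef_add hcoef_smult hcoef_zero\<close>)

lemma abelian_group_SR_Hom:
  "abelian_group (SR_Hom V \<Delta> :: (('v, 'k::field) mpoly, _) module)"
proof (rule abelian_groupI)
  fix x :: "('v, 'k) mpoly \<Rightarrow> ('v, 'k) mpoly set" assume "x \<in> carrier (SR_Hom V \<Delta>)"
  then show "\<exists>y\<in>carrier (SR_Hom V \<Delta>). y \<oplus>\<^bsub>SR_Hom V \<Delta>\<^esub> x = \<zero>\<^bsub>SR_Hom V \<Delta>\<^esub>"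
    by (intro bexI[of _ "Const (-1) \<odot>\<^bsub>SR_Hom V \<Delta>\<^esub> x"] SR_Hom_neg) simp_all
next
  fix x y z :: "('v, 'k) mpoly \<Rightarrow> ('v, 'k) mpoly set"
  assume *: "x \<in> carrier (SR_Hom V \<Delta>)" "y \<in> carrier (SR_Hom V \<Delta>)" "z \<in> carrier (SR_Hom V \<Delta>)"
  show "x \<oplus>\<^bsub>SR_Hom V \<Delta>\<^esub> y \<oplus>\<^bsub>SR_Hom V \<Delta>\<^esub> z = x \<oplus>\<^bsub>SR_Hom V \<Delta>\<^esub> (y \<oplus>\<^bsub>SR_Hom V \<Delta>\<^esub> z)"
    by (rule SR_Hom_eqI) (use * in \<open>simp_all add: hcoef_add add.assoc\<close>)
next
  fix x y :: "('v, 'k) mpoly \<Rightarrow> ('v, 'k) mpoly set"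
  assume *: "x \<in> carrier (SR_Hom V \<Delta>)" "y \<in> carrier (SR_Hom V \<Delta>)"
  show "x \<oplus>\<^bsub>SR_Hom V \<Delta>\<^esub> y = y \<oplus>\<^bsub>SR_Hom V \<Delta>\<^esub> x"
    by (rule SR_Hom_eqI) (use * in \<open>simp_all add: hcoef_add add.commute\<close>)
  show "\<zero>\<^bsub>SR_Hom V \<Delta>\<^esub> \<oplus>\<^bsub>SR_Hom V \<Delta>\<^esub> x = x"
    by (rule SR_Hom_eqI) (use * in \<open>simp_all add: hcoef_add hcoef_zero\<close>)
qed simp_all

lemma delta_star_SR_Hom [simp]:
  assumes "d \<in> derivations V"
  shows "delta_star V \<Delta> d \<in> carrier (SR_Hom V \<Delta>)"
  unfolding delta_star_def
proof (rule SR_HomI)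
  fix f r :: "('v, 'a) mpoly" and n :: "'v \<Rightarrow>\<^sub>0 nat" assume *: "f \<in> SR_ideal V \<Delta>" "r \<in> polys V" "Poly_Mapping.keys n \<in> \<Delta>"
  have "d r * f \<in> SR_ideal V \<Delta>"
    using * derivationsD(1)[OF assms] by simp
  then have "Poly_Mapping.lookup (f * d r) n = 0"
    using * by (simp add: SR_ideal_iff mult.commute)
  then show "Poly_Mapping.lookup (d (r * f)) n = Poly_Mapping.lookup (r * d f) n"
    using * derivationsD(3)[OF assms, of r f] SR_ideal_polys[OF *(1)] by (simp add: lookup_add)
qed (simp_all add: derivationsD(1,2)[OF assms] SR_ideal_polys)

lemma hcoef_delta_star:
  assumes "d \<in> derivations V"
    "Poly_Mapping.keys m \<subseteq> V" "Poly_Mapping.keys m \<notin> \<Delta>" "Poly_Mapping.keys n \<in> \<Delta>"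
  shows "hcoef (delta_star V \<Delta> d) m n = Poly_Mapping.lookup (d (mon m)) n"
  unfolding delta_star_def
  by (rule hcoef_coset) (simp_all add: assms derivationsD(1)[OF assms(1)] SR_ideal_polys)

abbreviation trivial_Homs :: "(('v, 'k::field) mpoly \<Rightarrow> ('v, 'k) mpoly set) set" where
  "trivial_Homs \<equiv> delta_star V \<Delta> ` derivations V"

lemma trivial_Homs_add:
  assumes "\<phi> \<in> trivial_Homs" "\<psi> \<in> trivial_Homs"
  shows "\<phi> \<oplus>\<^bsub>SR_Hom V \<Delta>\<^esub> \<psi> \<in> trivial_Homs"
proof -
  obtain d d' where *: "d \<in> derivations V" "\<phi> = delta_star V \<Delta> d" "d' \<in> derivations V" "\<psi> = delta_star V \<Delta> d'"
    using assms by blast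
  have "\<phi> \<oplus>\<^bsub>SR_Hom V \<Delta>\<^esub> \<psi> = delta_star V \<Delta> (\<lambda>f. d f + d' f)"
    by (rule SR_Hom_eqI) (use * in \<open>simp_all add: derivations_add hcoef_add hcoef_delta_star lookup_add\<close>)
  then show ?thesis using * derivations_add by blast
qed

lemma trivial_Homs_smult:
  assumes "\<phi> \<in> trivial_Homs"
  shows "Const c \<odot>\<^bsub>SR_Hom V \<Delta>\<^esub> \<phi> \<in> trivial_Homs"
proof -
  obtain d where *: "d \<in> derivations V" "\<phi> = delta_star V \<Delta> d"
    using assms by blast
  have "Const c \<odot>\<^bsub>SR_Hom V \<Delta>\<^esub> \<phi> = delta_star V \<Delta> (\<lambda>f. Const c * d f)"
    by (rule SR_Hom_eqI) (use * in \<open>simp_all add: derivations_scale hcoef_smult hcoef_delta_star\<close>)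
  then show ?thesis using * derivations_scale by blast
qed

lemma trivial_Homs_zero: "\<zero>\<^bsub>SR_Hom V \<Delta> :: (('v, 'k::field) mpoly, _) module\<^esub> \<in> trivial_Homs"
proof -
  have "\<zero>\<^bsub>SR_Hom V \<Delta> :: (('v, 'k::field) mpoly, _) module\<^esub> = delta_star V \<Delta> (\<lambda>f. 0)"
    by (rule SR_Hom_eqI) (simp_all add: derivations_zero hcoef_zero hcoef_delta_star)
  then show ?thesis using derivations_zero by blast
qed

lemma trivial_Homs_subset: "trivial_Homs \<subseteq> carrier (SR_Hom V \<Delta>)"
  by auto

lemma abelian_subgroup_trivial_Homs:
  "abelian_subgroup trivial_Homs (SR_Hom V \<Delta> :: (('v, 'k::field) mpoly, _) module)"
proof (rule abelian_subgroupI3)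
  let ?H = "SR_Hom V \<Delta> :: (('v, 'k::field) mpoly, _) module"
  interpret abelian_group ?H by (rule abelian_group_SR_Hom)
  show "abelian_group ?H" by (rule abelian_group_SR_Hom)
  show "additive_subgroup trivial_Homs ?H"
  proof (rule additive_subgroupI, rule subgroup.intro)
    fix x assume x: "x \<in> (trivial_Homs :: (('v, 'k) mpoly \<Rightarrow> ('v, 'k) mpoly set) set)"
    then have "x \<in> carrier ?H" by auto
    then have "\<ominus>\<^bsub>?H\<^esub> x = Const (-1) \<odot>\<^bsub>?H\<^esub> x"
      using minus_equality[OF SR_Hom_neg] by simp
    then show "inv\<^bsub>add_monoid ?H\<^esub> x \<in> trivial_Homs"
      using trivial_Homs_smult[OF x] by (simp add: a_inv_def)
  next
    show "trivial_Homs \<subseteq> carrier (add_monoid ?H)" using trivial_Homs_subset by simp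
    show "x \<otimes>\<^bsub>add_monoid ?H\<^esub> y \<in> trivial_Homs" if "x \<in> trivial_Homs" "y \<in> trivial_Homs" for x y
      using trivial_Homs_add[OF that] by simp
    show "\<one>\<^bsub>add_monoid ?H\<^esub> \<in> trivial_Homs" using trivial_Homs_zero by simp
  qed
qed

abbreviation T1_class :: "(('v, 'k::field) mpoly \<Rightarrow> ('v, 'k) mpoly set) \<Rightarrow> (('v, 'k) mpoly \<Rightarrow> ('v, 'k) mpoly set) set" where
  "T1_class \<phi> \<equiv> trivial_Homs +>\<^bsub>SR_Hom V \<Delta>\<^esub> \<phi>"

lemma T1_class_eq_iff:
  fixes \<phi> \<psi> :: "('v, 'k::field) mpoly \<Rightarrow> ('v, 'k) mpoly set"
  assumes "\<phi> \<in> carrier (SR_Hom V \<Delta>)" "\<psi> \<in> carrier (SR_Hom V \<Delta>)"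
  shows "T1_class \<phi> = T1_class \<psi> \<longleftrightarrow> \<phi> \<oplus>\<^bsub>SR_Hom V \<Delta>\<^esub> (Const (-1) \<odot>\<^bsub>SR_Hom V \<Delta>\<^esub> \<psi>) \<in> trivial_Homs"
proof -
  let ?H = "SR_Hom V \<Delta> :: (('v, 'k::field) mpoly, _) module"
  interpret abelian_subgroup trivial_Homs ?H by (rule abelian_subgroup_trivial_Homs)
  have "\<ominus>\<^bsub>?H\<^esub> \<psi> = Const (-1) \<odot>\<^bsub>?H\<^esub> \<psi>"
    using minus_equality[OF SR_Hom_neg] assms by simp
  then show ?thesis
    using a_rcos_module[OF assms(2,1)] a_repr_independence' a_repr_independenceD assms by metis
qed

lemma T1_class_trivial_iff:
  fixes \<phi> :: "('v, 'k::field) mpoly \<Rightarrow> ('v, 'k) mpoly set"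
  assumes "\<phi> \<in> carrier (SR_Hom V \<Delta>)"
  shows "T1_class \<phi> = trivial_Homs \<longleftrightarrow> \<phi> \<in> trivial_Homs"
proof -
  interpret abelian_subgroup trivial_Homs "SR_Hom V \<Delta> :: (('v, 'k::field) mpoly, _) module"
    by (rule abelian_subgroup_trivial_Homs)
  show ?thesis using a_rcos_self[OF assms] a_rcos_const by blast
qed

lemma T1_class_add:
  fixes \<phi> \<psi> :: "('v, 'k::field) mpoly \<Rightarrow> ('v, 'k) mpoly set"
  assumes "\<phi> \<in> carrier (SR_Hom V \<Delta>)" "\<psi> \<in> carrier (SR_Hom V \<Delta>)"
  shows "T1_class \<phi> \<oplus>\<^bsub>T1 V \<Delta>\<^esub> T1_class \<psi> = T1_class (\<phi> \<oplus>\<^bsub>SR_Hom V \<Delta>\<^esub> \<psi>)"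
proof -
  interpret abelian_subgroup trivial_Homs "SR_Hom V \<Delta> :: (('v, 'k::field) mpoly, _) module"
    by (rule abelian_subgroup_trivial_Homs)
  show ?thesis using a_rcos_sum[OF assms] by (simp add: T1_def restrict_scalars_def quot_module_def)
qed

lemma T1_class_smult:
  fixes \<phi> :: "('v, 'k::field) mpoly \<Rightarrow> ('v, 'k) mpoly set"
  assumes "\<phi> \<in> carrier (SR_Hom V \<Delta>)"
  shows "c \<odot>\<^bsub>T1 V \<Delta>\<^esub> T1_class \<phi> = T1_class (Const c \<odot>\<^bsub>SR_Hom V \<Delta>\<^esub> \<phi>)"
proof -
  let ?H = "SR_Hom V \<Delta> :: (('v, 'k::field) mpoly, _) module"
  interpret abelian_subgroup trivial_Homs ?H by (rule abelian_subgroup_trivial_Homs)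
  have "T1_class (Const c \<odot>\<^bsub>?H\<^esub> \<psi>) = T1_class (Const c \<odot>\<^bsub>?H\<^esub> \<phi>)" if "\<psi> \<in> T1_class \<phi>" for \<psi>
  proof -
    have psi: "\<psi> \<in> carrier ?H" using that a_elemrcos_carrier assms by blast
    have "T1_class \<psi> = T1_class \<phi>" using a_repr_independence'[OF that assms] by simp
    then have "\<psi> \<oplus>\<^bsub>?H\<^esub> (Const (-1) \<odot>\<^bsub>?H\<^esub> \<phi>) \<in> trivial_Homs" using T1_class_eq_iff psi assms by blast
    then have "Const c \<odot>\<^bsub>?H\<^esub> (\<psi> \<oplus>\<^bsub>?H\<^esub> (Const (-1) \<odot>\<^bsub>?H\<^esub> \<phi>)) \<in> trivial_Homs" by (rule trivial_Homs_smult)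
    also have "Const c \<odot>\<^bsub>?H\<^esub> (\<psi> \<oplus>\<^bsub>?H\<^esub> (Const (-1) \<odot>\<^bsub>?H\<^esub> \<phi>))
      = (Const c \<odot>\<^bsub>?H\<^esub> \<psi>) \<oplus>\<^bsub>?H\<^esub> (Const (-1) \<odot>\<^bsub>?H\<^esub> (Const c \<odot>\<^bsub>?H\<^esub> \<phi>))"
      by (rule SR_Hom_eqI) (use psi assms in \<open>simp_all add: hcoef_add hcoef_smult algebra_simps\<close>)
    finally show ?thesis using T1_class_eq_iff[OF SR_Hom_smult[OF psi] SR_Hom_smult[OF assms]] by blast
  qed
  then have "(\<Union>\<psi>\<in>T1_class \<phi>. T1_class (Const c \<odot>\<^bsub>?H\<^esub> \<psi>)) = T1_class (Const c \<odot>\<^bsub>?H\<^esub> \<phi>)"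
  proof (rule SUP_eq_const[rotated])
    show "T1_class \<phi> \<noteq> {}" using a_rcos_self[OF assms] by blast
  qed
  then show ?thesis
    by (simp add: T1_def restrict_scalars_def quot_module_def)
qed

lemma SR_Hom_component_subset: "SR_Hom_component V \<Delta> c \<subseteq> carrier (SR_Hom V \<Delta>)"
  by (auto simp: SR_Hom_component_def)

lemma T1_component_simps [simp]:
  "carrier (T1_component V \<Delta> c) = T1_class ` SR_Hom_component V \<Delta> c"
  "add (T1_component V \<Delta> c) = add (T1 V \<Delta>)"
  "smult (T1_component V \<Delta> c) = smult (T1 V \<Delta>)"
  "\<zero>\<^bsub>T1_component V \<Delta> c\<^esub> = trivial_Homs"
  by (simp_all add: T1_component_def T1_def restrict_scalars_def quot_module_def)

lemma rigid_iff:
  "rigid TYPE('k::field) V \<Delta> \<longleftrightarrow>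
     (carrier (SR_Hom V \<Delta>) \<subseteq> (trivial_Homs :: (('v, 'k) mpoly \<Rightarrow> ('v, 'k) mpoly set) set))"
proof -
  let ?H = "SR_Hom V \<Delta> :: (('v, 'k::field) mpoly, _) module"
  have ne: "carrier ?H \<noteq> {}" using SR_Hom_zero by (metis empty_iff)
  have "rigid TYPE('k) V \<Delta> \<longleftrightarrow> T1_class ` carrier ?H = {trivial_Homs}"
    unfolding rigid_def zero_module_def
    by (simp add: T1_def restrict_scalars_def quot_module_def A_RCOSETS_def' UNION_singleton_eq_range)
  also have "\<dots> \<longleftrightarrow> (\<forall>\<phi>\<in>carrier ?H. T1_class \<phi> = trivial_Homs)"
    by (rule image_eq_singleton_iff[OF ne])
  also have "\<dots> \<longleftrightarrow> (\<forall>\<phi>\<in>carrier ?H. \<phi> \<in> trivial_Homs)"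
    by (rule ball_cong[OF refl T1_class_trivial_iff])
  finally show ?thesis by (simp only: subset_eq)
qed

lemma zero_T1_component_iff:
  assumes "SR_Hom_component V \<Delta> c \<noteq> ({} :: (('v, 'k::field) mpoly \<Rightarrow> ('v, 'k) mpoly set) set)"
  shows "zero_module (T1_component V \<Delta> c :: ('k, _) module) \<longleftrightarrow>
     (SR_Hom_component V \<Delta> c \<subseteq> (trivial_Homs :: (('v, 'k) mpoly \<Rightarrow> ('v, 'k) mpoly set) set))"
proof -
  let ?C = "SR_Hom_component V \<Delta> c :: (('v, 'k) mpoly \<Rightarrow> ('v, 'k) mpoly set) set"
  have "zero_module (T1_component V \<Delta> c :: ('k, _) module) \<longleftrightarrow> T1_class ` ?C = {trivial_Homs}"
    by (simp only: zero_module_def T1_component_simps)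
  also have "\<dots> \<longleftrightarrow> (\<forall>\<phi>\<in>?C. T1_class \<phi> = trivial_Homs)"
    by (rule image_eq_singleton_iff[OF assms])
  also have "\<dots> \<longleftrightarrow> (\<forall>\<phi>\<in>?C. \<phi> \<in> trivial_Homs)"
    by (rule ball_cong[OF refl T1_class_trivial_iff]) (rule subsetD[OF SR_Hom_component_subset])
  finally show ?thesis by (simp only: subset_eq)
qed

end

section \<open>Graded components as functions on exponents\<close>

lemma exponent_induct [case_names zero add]:
  fixes m :: "'v \<Rightarrow>\<^sub>0 nat"
  assumes "P 0" and step: "\<And>w m. P m \<Longrightarrow> P (Poly_Mapping.single w 1 + m)"
  shows "P m"
proof (induction m rule: update_induct)
  case (update f a b)
  have "P (Poly_Mapping.single a b + f)" for b
  proof (induction b)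
    case (Suc b)
    have "Poly_Mapping.single a (Suc b) + f = Poly_Mapping.single a 1 + (Poly_Mapping.single a b + f)"
      by (simp add: add.assoc[symmetric] single_add[symmetric])
    then show ?case using step[OF Suc] by simp
  qed (simp add: update)
  moreover have "Poly_Mapping.update a b f = Poly_Mapping.single a b + f"
    using update by (intro poly_mapping_eqI) (auto simp: lookup_update lookup_add lookup_single when_def in_keys_iff)
  ultimately show ?case by simp
qed (rule assms)

lemma mpoly_mult_expand:
  "r * f = (\<Sum>u\<in>Poly_Mapping.keys r. \<Sum>m\<in>Poly_Mapping.keys f.
     Const (Poly_Mapping.lookup r u * Poly_Mapping.lookup f m) * mon (u + m))"
proof -
  have "r * f = (\<Sum>u\<in>Poly_Mapping.keys r. Const (Poly_Mapping.lookup r u) * mon u) *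
     (\<Sum>m\<in>Poly_Mapping.keys f. Const (Poly_Mapping.lookup f m) * mon m)"
    by (simp only: mpoly_expand[symmetric])
  also have "\<dots> = (\<Sum>u\<in>Poly_Mapping.keys r. \<Sum>m\<in>Poly_Mapping.keys f.
     Const (Poly_Mapping.lookup r u) * mon u * (Const (Poly_Mapping.lookup f m) * mon m))"
    by (rule sum_product)
  also have "\<dots> = (\<Sum>u\<in>Poly_Mapping.keys r. \<Sum>m\<in>Poly_Mapping.keys f.
     Const (Poly_Mapping.lookup r u * Poly_Mapping.lookup f m) * mon (u + m))"
    by (intro sum.cong refl) (simp add: Const_def mult_single)
  finally show ?thesis .
qed

lemma lin_ext_mult_left:
  "lin_ext g (r * f) = (\<Sum>u\<in>Poly_Mapping.keys r. \<Sum>m\<in>Poly_Mapping.keys f.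
     Const (Poly_Mapping.lookup r u * Poly_Mapping.lookup f m) * g (u + m))"
  by (subst mpoly_mult_expand) (simp only: lin_ext_sum lin_ext_Const lin_ext_mon)

lemma mult_lin_ext:
  "r * lin_ext g f = (\<Sum>u\<in>Poly_Mapping.keys r. \<Sum>m\<in>Poly_Mapping.keys f.
     Const (Poly_Mapping.lookup r u * Poly_Mapping.lookup f m) * (mon u * g m))"
proof -
  have "r * lin_ext g f = (\<Sum>u\<in>Poly_Mapping.keys r. Const (Poly_Mapping.lookup r u) * mon u) * lin_ext g f"
    by (simp only: mpoly_expand[symmetric])
  also have "\<dots> = (\<Sum>u\<in>Poly_Mapping.keys r. \<Sum>m\<in>Poly_Mapping.keys f.
     Const (Poly_Mapping.lookup r u) * mon u * (Const (Poly_Mapping.lookup f m) * g m))"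
    unfolding lin_ext_def by (rule sum_product)
  also have "\<dots> = (\<Sum>u\<in>Poly_Mapping.keys r. \<Sum>m\<in>Poly_Mapping.keys f.
     Const (Poly_Mapping.lookup r u * Poly_Mapping.lookup f m) * (mon u * g m))"
    by (simp add: Const_mult algebra_simps)
  finally show ?thesis .
qed

lemma polys_lin_ext:
  "f \<in> polys V \<Longrightarrow> (\<And>m. Poly_Mapping.keys m \<subseteq> V \<Longrightarrow> g m \<in> polys V) \<Longrightarrow> lin_ext g f \<in> polys V"
  unfolding lin_ext_def by (intro polys_sum polys_mult polys_Const) (auto dest: polysD)

text \<open>Negative entries of \<open>m + c\<close> are truncated to \<open>0\<close>.\<close>

definition shift :: "'v set \<Rightarrow> ('v \<Rightarrow> int) \<Rightarrow> ('v \<Rightarrow>\<^sub>0 nat) \<Rightarrow> ('v \<Rightarrow>\<^sub>0 nat)" where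
  "shift V c m = Abs_poly_mapping (\<lambda>v. if v \<in> V then nat (int (Poly_Mapping.lookup m v) + c v) else 0)"

definition admissible :: "'v set \<Rightarrow> 'v set set \<Rightarrow> ('v \<Rightarrow> int) \<Rightarrow> ('v \<Rightarrow>\<^sub>0 nat) set" where
  "admissible V \<Delta> c = {m. Poly_Mapping.keys m \<subseteq> V \<and> Poly_Mapping.keys m \<notin> \<Delta> \<and>
     (\<forall>v\<in>V. 0 \<le> int (Poly_Mapping.lookup m v) + c v) \<and> Poly_Mapping.keys (shift V c m) \<in> \<Delta>}"

text \<open>
  In the second condition \<open>m\<close> need not be admissible. If it is not, then \<open>l m = 0\<close>, and the condition
  expresses that \<open>x\<^sup>u\<close> times the zero image of \<open>x\<^sup>m\<close> is zero.
\<close>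

definition hom_coeffs :: "'v set \<Rightarrow> 'v set set \<Rightarrow> ('v \<Rightarrow> int) \<Rightarrow> (('v \<Rightarrow>\<^sub>0 nat) \<Rightarrow> 'k::field) set" where
  "hom_coeffs V \<Delta> c = {l. (\<forall>m. l m \<noteq> 0 \<longrightarrow> m \<in> admissible V \<Delta> c) \<and>
     (\<forall>m u. Poly_Mapping.keys m \<subseteq> V \<and> Poly_Mapping.keys m \<notin> \<Delta> \<and> m + u \<in> admissible V \<Delta> c \<longrightarrow> l (m + u) = l m)}"

text \<open>
  The derivation \<open>\<Sum>\<^sub>w \<alpha> w x\<^sup>c x\<^sub>w \<partial>\<^sub>w\<close> multiplies \<open>x\<^sup>m\<close> by \<open>log_weight V \<alpha> m\<close> times \<open>x\<^sup>c\<close>; it is defined on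
  polynomials precisely if \<open>x\<^sup>c x\<^sub>w\<close> is a monomial whenever \<open>\<alpha> w \<noteq> 0\<close>.
\<close>

definition log_weight :: "'v set \<Rightarrow> ('v \<Rightarrow> 'k) \<Rightarrow> ('v \<Rightarrow>\<^sub>0 nat) \<Rightarrow> 'k::field" where
  "log_weight V \<alpha> m = (\<Sum>w\<in>V. of_nat (Poly_Mapping.lookup m w) * \<alpha> w)"

definition log_admissible :: "'v set \<Rightarrow> ('v \<Rightarrow> int) \<Rightarrow> ('v \<Rightarrow> 'k::field) \<Rightarrow> bool" where
  "log_admissible V c \<alpha> \<longleftrightarrow> (\<forall>w\<in>V. \<alpha> w \<noteq> 0 \<longrightarrow> (\<forall>v\<in>V. 0 \<le> (if v = w then 1 else 0) + c v))"

definition der_coeffs :: "'v set \<Rightarrow> 'v set set \<Rightarrow> ('v \<Rightarrow> int) \<Rightarrow> (('v \<Rightarrow>\<^sub>0 nat) \<Rightarrow> 'k::field) set" where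
  "der_coeffs V \<Delta> c = {l. \<exists>\<alpha>. log_admissible V c \<alpha> \<and> (\<forall>m\<in>admissible V \<Delta> c. l m = log_weight V \<alpha> m)}"

lemma lookup_shift:
  assumes "finite V"
  shows "Poly_Mapping.lookup (shift V c m) v = (if v \<in> V then nat (int (Poly_Mapping.lookup m v) + c v) else 0)"
proof -
  have "finite {v. (if v \<in> V then nat (int (Poly_Mapping.lookup m v) + c v) else 0) \<noteq> 0}"
    by (rule finite_subset[OF _ assms]) auto
  then show ?thesis by (simp add: shift_def)
qed

lemma keys_shift: "finite V \<Longrightarrow> Poly_Mapping.keys (shift V c m) \<subseteq> V"
  by (auto simp: in_keys_iff lookup_shift split: if_splits)

lemma shift_add:
  assumes "finite V" "Poly_Mapping.keys u \<subseteq> V" "\<And>v. v \<in> V \<Longrightarrow> 0 \<le> int (Poly_Mapping.lookup m v) + c v"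
  shows "shift V c (u + m) = u + shift V c m"
proof (rule poly_mapping_eqI)
  fix v
  show "Poly_Mapping.lookup (shift V c (u + m)) v = Poly_Mapping.lookup (u + shift V c m) v"
    using assms(2) assms(3)[of v] by (auto simp: lookup_shift[OF assms(1)] lookup_add nat_add_distrib in_keys_iff)
qed

lemma eq_shiftI:
  assumes "finite V" "Poly_Mapping.keys n \<subseteq> V" "\<And>v. v \<in> V \<Longrightarrow> int (Poly_Mapping.lookup n v) = int (Poly_Mapping.lookup m v) + c v"
  shows "n = shift V c m" "\<And>v. v \<in> V \<Longrightarrow> 0 \<le> int (Poly_Mapping.lookup m v) + c v"
proof (rule poly_mapping_eqI)
  fix v show "Poly_Mapping.lookup n v = Poly_Mapping.lookup (shift V c m) v"
    using assms(2) assms(3)[of v, symmetric] by (auto simp: lookup_shift[OF assms(1)] in_keys_iff)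
next
  fix v assume "v \<in> V" then show "0 \<le> int (Poly_Mapping.lookup m v) + c v"
    using assms(3)[of v] by linarith
qed

lemma lookup_shift_int:
  assumes "finite V" "v \<in> V" "0 \<le> int (Poly_Mapping.lookup m v) + c v"
  shows "int (Poly_Mapping.lookup (shift V c m) v) = int (Poly_Mapping.lookup m v) + c v"
  using assms by (simp add: lookup_shift)

lemma log_weight_add: "log_weight V \<alpha> (u + m) = log_weight V \<alpha> u + log_weight V \<alpha> m"
  by (simp add: log_weight_def lookup_add distrib_right sum.distrib)

lemma log_admissibleD:
  assumes "log_admissible V c \<alpha>" "log_weight V \<alpha> m \<noteq> 0" "v \<in> V"
  shows "0 \<le> int (Poly_Mapping.lookup m v) + c v"
proof -
  obtain w where w: "w \<in> V" "of_nat (Poly_Mapping.lookup m w) * \<alpha> w \<noteq> 0"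
    using assms(2) unfolding log_weight_def by (meson sum.neutral)
  then have "Poly_Mapping.lookup m w \<noteq> 0" "\<alpha> w \<noteq> 0" by (auto intro: ccontr)
  then have "0 \<le> (if v = w then 1 else 0) + c v" using assms w by (auto simp: log_admissible_def)
  then show ?thesis using \<open>Poly_Mapping.lookup m w \<noteq> 0\<close> by (auto split: if_splits)
qed

definition log_derivation :: "'v set \<Rightarrow> ('v \<Rightarrow> int) \<Rightarrow> ('v \<Rightarrow> 'k) \<Rightarrow> ('v, 'k::field) mpoly \<Rightarrow> ('v, 'k) mpoly" where
  "log_derivation V c \<alpha> = lin_ext (\<lambda>m. Const (log_weight V \<alpha> m) * mon (shift V c m))"

lemma log_derivation_derivation:
  fixes \<alpha> :: "'v \<Rightarrow> 'k::field"
  assumes "finite V" "log_admissible V c \<alpha>"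
  shows "log_derivation V c \<alpha> \<in> derivations V"
proof -
  let ?g = "\<lambda>m. Const (log_weight V \<alpha> m) * (mon (shift V c m) :: ('v, 'k) mpoly)"
  have half: "Const (log_weight V \<alpha> m) * mon (shift V c (u + m)) = mon u * ?g m"
    if "Poly_Mapping.keys u \<subseteq> V" for u m
  proof (cases "log_weight V \<alpha> m = 0")
    case False
    have "shift V c (u + m) = u + shift V c m"
      by (rule shift_add[OF assms(1) that log_admissibleD[OF assms(2) False]])
    then show ?thesis by (simp add: Const_def mult_single)
  qed simp
  have leibniz: "?g (u + m) = mon u * ?g m + mon m * ?g u"
    if "Poly_Mapping.keys u \<subseteq> V" "Poly_Mapping.keys m \<subseteq> V" for u m
    using half[OF that(1), of m] half[OF that(2), of u]
    by (simp add: log_weight_add Const_add distrib_right add.commute)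
  have "lin_ext ?g (f * h) = f * lin_ext ?g h + h * lin_ext ?g f" if "f \<in> polys V" "h \<in> polys V" for f h
  proof -
    have "lin_ext ?g (f * h) = (\<Sum>u\<in>Poly_Mapping.keys f. \<Sum>m\<in>Poly_Mapping.keys h.
        Const (Poly_Mapping.lookup f u * Poly_Mapping.lookup h m) * (mon u * ?g m) +
        Const (Poly_Mapping.lookup h m * Poly_Mapping.lookup f u) * (mon m * ?g u))"
      unfolding lin_ext_mult_left
    proof (intro sum.cong refl)
      fix u m assume "u \<in> Poly_Mapping.keys f" "m \<in> Poly_Mapping.keys h"
      then have "Poly_Mapping.keys u \<subseteq> V" "Poly_Mapping.keys m \<subseteq> V" using that polysD by blast+
      from leibniz[OF this] show "Const (Poly_Mapping.lookup f u * Poly_Mapping.lookup h m) * ?g (u + m) =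
        Const (Poly_Mapping.lookup f u * Poly_Mapping.lookup h m) * (mon u * ?g m) +
        Const (Poly_Mapping.lookup h m * Poly_Mapping.lookup f u) * (mon m * ?g u)"
        by (simp only: distrib_left mult.commute[of "Poly_Mapping.lookup h m"])
    qed
    also have "\<dots> = f * lin_ext ?g h + h * lin_ext ?g f"
      unfolding mult_lin_ext sum.distrib
      by (subst (4) sum.swap) (rule refl)
    finally show ?thesis .
  qed
  moreover have "lin_ext ?g f \<in> polys V" if "f \<in> polys V" for f
    by (rule polys_lin_ext[OF that]) (simp add: keys_shift[OF assms(1)])
  ultimately show ?thesis
    unfolding derivations_def log_derivation_def mpoly_ring_simps
    by (intro CollectI conjI ballI allI Pi_I) (assumption | simp only: lin_ext_add lin_ext_Const)+
qed

lemma derivations_sum: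
  assumes "\<And>x. x \<in> A \<Longrightarrow> D x \<in> derivations V"
  shows "(\<lambda>f. \<Sum>x\<in>A. D x f) \<in> derivations V"
  using assms
  by (induction A rule: infinite_finite_induct)
    (simp_all add: derivations_zero derivations_add)

lemma derivation_mon:
  fixes d :: "('v, 'k::field) mpoly \<Rightarrow> ('v, 'k) mpoly"
  assumes d: "d \<in> derivations V" and "finite V"
  shows "Poly_Mapping.keys m \<subseteq> V \<Longrightarrow> d (mon m) =
     (\<Sum>w\<in>V. Const (of_nat (Poly_Mapping.lookup m w)) * (mon (m - Poly_Mapping.single w 1) * d (mon (Poly_Mapping.single w 1))))"
proof (induction m rule: exponent_induct)
  case zero
  have "d (1 * 1) = 1 * d 1 + 1 * d 1"
    by (rule derivationsD(3)[OF d]) simp_all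
  then have "d 1 = 0" by (metis add_cancel_left_right mult_1_left)
  then show ?case by simp
next
  case (add x m)
  let ?e = "\<lambda>w. Poly_Mapping.single w (1::nat)"
  have keys: "Poly_Mapping.keys m \<subseteq> V" "x \<in> V" using add.prems by (auto simp: keys_nat_add)
  have shift: "mon (?e x) * (Const (of_nat (Poly_Mapping.lookup m w)) * (mon (m - ?e w) * d (mon (?e w)))) =
     Const (of_nat (Poly_Mapping.lookup m w)) * (mon (?e x + m - ?e w) * d (mon (?e w)))" for w
  proof (cases "Poly_Mapping.lookup m w = 0")
    case False
    have "?e x + (m - ?e w) = ?e x + m - ?e w"
      using False by (intro poly_mapping_eqI) (auto simp: lookup_add lookup_minus lookup_single when_def)
    then have "mon (?e x) * mon (m - ?e w) = (mon (?e x + m - ?e w) :: ('v, 'k) mpoly)" by (simp add: mult_single)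
    moreover have "X * (C * (Y * Z)) = C * ((X * Y) * Z)" for X C Y Z :: "('v, 'k) mpoly"
      by (simp only: mult.assoc mult.left_commute)
    ultimately show ?thesis by (simp only:)
  qed simp
  have "d (mon (?e x + m)) = d (mon (?e x) * mon m)" by (simp add: mult_single)
  also have "\<dots> = mon (?e x) * d (mon m) + mon m * d (mon (?e x))"
    using d keys unfolding derivations_def by simp
  also have "mon (?e x) * d (mon m) =
     (\<Sum>w\<in>V. Const (of_nat (Poly_Mapping.lookup m w)) * (mon (?e x + m - ?e w) * d (mon (?e w))))"
    unfolding add.IH[OF keys(1)] sum_distrib_left by (rule sum.cong[OF refl shift])
  also have "mon m * d (mon (?e x)) =
     (\<Sum>w\<in>V. if w = x then mon (?e x + m - ?e w) * d (mon (?e w)) else 0)"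
    using keys \<open>finite V\<close> by simp
  also have "(\<Sum>w\<in>V. Const (of_nat (Poly_Mapping.lookup m w)) * (mon (?e x + m - ?e w) * d (mon (?e w)))) + \<dots> =
     (\<Sum>w\<in>V. Const (of_nat (Poly_Mapping.lookup (?e x + m) w)) * (mon (?e x + m - ?e w) * d (mon (?e w))))"
    unfolding sum.distrib[symmetric]
    by (rule sum.cong) (auto simp: lookup_add lookup_single when_def Const_add distrib_right)
  finally show ?case .
qed

context complex
begin

lemma admissible_iff:
  assumes "Poly_Mapping.keys m \<subseteq> V" "Poly_Mapping.keys m \<notin> \<Delta>" "Poly_Mapping.keys n \<in> \<Delta>"
    "\<And>v. v \<in> V \<Longrightarrow> int (Poly_Mapping.lookup n v) = int (Poly_Mapping.lookup m v) + c v"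
  shows "m \<in> admissible V \<Delta> c" "n = shift V c m"
  using eq_shiftI[OF finite_V faces_subset[OF assms(3)] assms(4)] assms
  by (auto simp: admissible_def)

lemma admissibleD:
  assumes "m \<in> admissible V \<Delta> c"
  shows "Poly_Mapping.keys m \<subseteq> V" "Poly_Mapping.keys m \<notin> \<Delta>" "Poly_Mapping.keys (shift V c m) \<in> \<Delta>"
    "v \<in> V \<Longrightarrow> 0 \<le> int (Poly_Mapping.lookup m v) + c v"
    "v \<in> V \<Longrightarrow> int (Poly_Mapping.lookup (shift V c m) v) = int (Poly_Mapping.lookup m v) + c v"
  using assms by (auto simp: admissible_def lookup_shift_int[OF finite_V])

definition deg_coef :: "('v \<Rightarrow> int) \<Rightarrow> (('v, 'k::field) mpoly \<Rightarrow> ('v, 'k) mpoly set) \<Rightarrow> ('v \<Rightarrow>\<^sub>0 nat) \<Rightarrow> 'k" where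
  "deg_coef c \<phi> m = (if m \<in> admissible V \<Delta> c then hcoef \<phi> m (shift V c m) else 0)"

lemma hcoef_add_exponent:
  assumes "\<phi> \<in> carrier (SR_Hom V \<Delta>)" "Poly_Mapping.keys m \<subseteq> V" "Poly_Mapping.keys m \<notin> \<Delta>"
    "Poly_Mapping.keys u \<subseteq> V" "Poly_Mapping.keys n \<in> \<Delta>"
  shows "hcoef \<phi> (u + m) n = Poly_Mapping.lookup (mon u * rep \<phi> (mon m)) n"
proof -
  have "hcoef \<phi> (u + m) n = Poly_Mapping.lookup (rep \<phi> (mon u * mon m)) n"
    by (simp add: hcoef_def mult_single)
  also have "\<dots> = Poly_Mapping.lookup (mon u * rep \<phi> (mon m)) n"
    using assms by (intro rep_mult) auto
  finally show ?thesis .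
qed

lemma deg_coef_hom_coeffs:
  assumes "\<phi> \<in> carrier (SR_Hom V \<Delta>)"
  shows "deg_coef c \<phi> \<in> hom_coeffs V \<Delta> c"
  unfolding hom_coeffs_def
proof (intro CollectI conjI allI impI)
  fix m :: "'v \<Rightarrow>\<^sub>0 nat" assume "deg_coef c \<phi> m \<noteq> 0"
  then show "m \<in> admissible V \<Delta> c" by (auto simp: deg_coef_def split: if_splits)
next
  fix m u :: "'v \<Rightarrow>\<^sub>0 nat"
  assume *: "Poly_Mapping.keys m \<subseteq> V \<and> Poly_Mapping.keys m \<notin> \<Delta> \<and> m + u \<in> admissible V \<Delta> c"
  note adm = admissibleD[OF conjunct2[OF conjunct2[OF *]]]
  have u: "Poly_Mapping.keys u \<subseteq> V" using adm(1) by (auto simp: keys_nat_add)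
  have eq: "deg_coef c \<phi> (m + u) = Poly_Mapping.lookup (mon u * rep \<phi> (mon m)) (shift V c (m + u))"
    using hcoef_add_exponent[OF assms _ _ u adm(3)] * by (simp add: deg_coef_def add.commute)
  show "deg_coef c \<phi> (m + u) = deg_coef c \<phi> m"
  proof (cases "m \<in> admissible V \<Delta> c")
    case True
    have "shift V c (m + u) = u + shift V c m"
      using shift_add[OF finite_V u, of m c] admissibleD(4)[OF True] by (simp add: add.commute)
    then show ?thesis using True unfolding eq by (simp add: deg_coef_def hcoef_def)
  next
    case False
    have "Poly_Mapping.lookup (mon u * rep \<phi> (mon m)) (shift V c (m + u)) = 0"
    proof (rule ccontr)
      assume "\<not> ?thesis"
      then obtain q where q: "shift V c (m + u) = u + q" using lookup_mon_mult by blast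
      have "Poly_Mapping.keys q \<in> \<Delta>"
        using adm(3) face_mono unfolding q keys_nat_add by blast
      moreover have "int (Poly_Mapping.lookup q v) = int (Poly_Mapping.lookup m v) + c v" if "v \<in> V" for v
        using adm(5)[OF that] unfolding q by (simp add: lookup_add)
      ultimately have "m \<in> admissible V \<Delta> c" using * by (intro admissible_iff(1)) auto
      with False show False ..
    qed
    then show ?thesis using False unfolding eq by (simp add: deg_coef_def)
  qed
qed

definition hom_of :: "('v \<Rightarrow> int) \<Rightarrow> (('v \<Rightarrow>\<^sub>0 nat) \<Rightarrow> 'k) \<Rightarrow> ('v, 'k::field) mpoly \<Rightarrow> ('v, 'k) mpoly set" where
  "hom_of c l = (\<lambda>f\<in>SR_ideal V \<Delta>. coset (lin_ext (\<lambda>m. Const (l m) * mon (shift V c m)) f))"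

lemma polys_shift_ext [simp]:
  "f \<in> polys V \<Longrightarrow> lin_ext (\<lambda>m. Const (l m) * mon (shift V c m)) f \<in> polys V"
  by (erule polys_lin_ext) (simp add: keys_shift[OF finite_V])

lemma hom_of_SR_Hom:
  fixes l :: "('v \<Rightarrow>\<^sub>0 nat) \<Rightarrow> 'k::field"
  assumes l: "l \<in> hom_coeffs V \<Delta> c"
  shows "hom_of c l \<in> carrier (SR_Hom V \<Delta>)"
  unfolding hom_of_def
proof (rule SR_HomI)
  let ?g = "\<lambda>m. Const (l m) * (mon (shift V c m) :: ('v, 'k) mpoly)"
  fix f r :: "('v, 'k) mpoly" and n :: "'v \<Rightarrow>\<^sub>0 nat"
  assume f: "f \<in> SR_ideal V \<Delta>" and r: "r \<in> polys V" and n: "Poly_Mapping.keys n \<in> \<Delta>"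
  have "Poly_Mapping.lookup (?g (u + m)) n = Poly_Mapping.lookup (mon u * ?g m) n"
    if u: "Poly_Mapping.keys u \<subseteq> V" and m: "Poly_Mapping.keys m \<subseteq> V" "Poly_Mapping.keys m \<notin> \<Delta>" for u m
  proof -
    have um: "Poly_Mapping.keys (u + m) \<subseteq> V" "Poly_Mapping.keys (u + m) \<notin> \<Delta>"
      using u m face_mono by (auto simp: keys_nat_add)
    have g: "mon u * ?g m = Const (l m) * mon (u + shift V c m)"
      by (simp add: Const_def mult_single)
    have stable: "u + m \<in> admissible V \<Delta> c \<Longrightarrow> l (u + m) = l m"
      and support: "\<And>m. l m \<noteq> 0 \<Longrightarrow> m \<in> admissible V \<Delta> c"
      using l m by (auto simp: hom_coeffs_def add.commute[of u])
    show ?thesis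
    proof (cases "l m = 0")
      case True
      then have "l (u + m) = 0" using stable support by metis
      with True show ?thesis by simp
    next
      case False
      note adm = admissibleD[OF support[OF False]]
      have sh: "shift V c (u + m) = u + shift V c m" by (rule shift_add[OF finite_V u adm(4)])
      show ?thesis
      proof (cases "u + m \<in> admissible V \<Delta> c")
        case True
        then show ?thesis unfolding g sh using stable by simp
      next
        case not_adm: False
        have "n \<noteq> u + shift V c m"
        proof
          assume eq: "n = u + shift V c m"
          have "u + m \<in> admissible V \<Delta> c"
            by (rule admissible_iff(1)[OF um n]) (use adm(5) in \<open>simp add: eq lookup_add\<close>)
          with not_adm show False ..
        qed
        then show ?thesis unfolding g sh by (simp add: lookup_single)
      qed
    qed
  qed
  note mon_case = this
  show "Poly_Mapping.lookup (lin_ext ?g (r * f)) n = Poly_Mapping.lookup (r * lin_ext ?g f) n"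
    unfolding lin_ext_mult_left mult_lin_ext lookup_sum lookup_Const_mult[of "_ * _"]
  proof (intro sum.cong refl arg_cong2[of _ _ _ _ "(*)"] mon_case)
    show "Poly_Mapping.keys u \<subseteq> V" if "u \<in> Poly_Mapping.keys r" for u using polysD[OF r that] .
    show "Poly_Mapping.keys m \<subseteq> V" if "m \<in> Poly_Mapping.keys f" for m
      using polysD[OF SR_ideal_polys[OF f] that] .
    show "Poly_Mapping.keys m \<notin> \<Delta>" if "m \<in> Poly_Mapping.keys f" for m
      using f that by (auto simp: SR_ideal_eq)
  qed
qed (simp_all add: SR_ideal_polys lin_ext_add)

lemma hcoef_hom_of:
  fixes l :: "('v \<Rightarrow>\<^sub>0 nat) \<Rightarrow> 'k::field"
  assumes "Poly_Mapping.keys m \<subseteq> V" "Poly_Mapping.keys m \<notin> \<Delta>" "Poly_Mapping.keys n \<in> \<Delta>"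
  shows "hcoef (hom_of c l) m n = (if n = shift V c m then l m else 0)"
  unfolding hom_of_def
  by (subst hcoef_coset) (use assms in \<open>auto simp: SR_ideal_polys lookup_single when_def\<close>)

lemma deg_coef_hom_of:
  fixes l :: "('v \<Rightarrow>\<^sub>0 nat) \<Rightarrow> 'k::field"
  assumes "l \<in> hom_coeffs V \<Delta> c"
  shows "deg_coef c (hom_of c l) = l"
proof
  fix m
  show "deg_coef c (hom_of c l) m = l m"
    using assms by (auto simp: deg_coef_def hcoef_hom_of admissibleD hom_coeffs_def)
qed

lemma hom_of_component:
  fixes l :: "('v \<Rightarrow>\<^sub>0 nat) \<Rightarrow> 'k::field"
  assumes l: "l \<in> hom_coeffs V \<Delta> c"
  shows "hom_of c l \<in> SR_Hom_component V \<Delta> c"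
  unfolding SR_Hom_component_def
proof (intro CollectI conjI hom_of_SR_Hom[OF l] allI ballI)
  fix e :: "'v \<Rightarrow> int" and f :: "('v, 'k) mpoly" assume f: "f \<in> SR_ideal V \<Delta> \<inter> mpoly_component V e"
  let ?p = "lin_ext (\<lambda>m. Const (l m) * (mon (shift V c m) :: ('v, 'k) mpoly)) f"
  have "int (Poly_Mapping.lookup n v) = e v + c v" if n: "n \<in> Poly_Mapping.keys ?p" and v: "v \<in> V" for n v
  proof -
    have "Poly_Mapping.lookup ?p n \<noteq> 0" using n by (simp add: in_keys_iff)
    then obtain m where m: "m \<in> Poly_Mapping.keys f"
      "Poly_Mapping.lookup (Const (l m) * (mon (shift V c m) :: ('v, 'k) mpoly)) n \<noteq> 0"
      unfolding lin_ext_def lookup_sum lookup_Const_mult[of "Poly_Mapping.lookup f _"]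
      by (metis (no_types, lifting) mult_zero_right sum.neutral)
    then have "l m \<noteq> 0" "n = shift V c m" by (auto simp: lookup_single when_def split: if_splits)
    moreover from this have "m \<in> admissible V \<Delta> c" using l by (auto simp: hom_coeffs_def)
    ultimately show ?thesis using admissibleD(5)[of m c v] f m(1) v by (auto simp: mpoly_component_def)
  qed
  moreover have "?p \<in> polys V" using f by (intro polys_shift_ext SR_ideal_polys) auto
  ultimately have "?p \<in> mpoly_component V (\<lambda>v. e v + c v)" by (simp add: mpoly_component_def)
  then show "hom_of c l f \<in> SR_component V \<Delta> (\<lambda>v. e v + c v)"
    using f by (simp add: hom_of_def SR_component_def)
qed

lemma SR_Hom_componentD:
  "\<phi> \<in> SR_Hom_component V \<Delta> c \<Longrightarrow> f \<in> SR_ideal V \<Delta> \<inter> mpoly_component V e \<Longrightarrow>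
     \<phi> f \<in> SR_component V \<Delta> (\<lambda>v. e v + c v)"
  by (simp add: SR_Hom_component_def)

lemma hcoef_component:
  fixes \<phi> :: "('v, 'k::field) mpoly \<Rightarrow> ('v, 'k) mpoly set"
  assumes \<phi>: "\<phi> \<in> SR_Hom_component V \<Delta> c"
    and m: "Poly_Mapping.keys m \<subseteq> V" "Poly_Mapping.keys m \<notin> \<Delta>" and n: "Poly_Mapping.keys n \<in> \<Delta>"
  shows "hcoef \<phi> m n = (if n = shift V c m then deg_coef c \<phi> m else 0)"
proof -
  have "mon m \<in> SR_ideal V \<Delta> \<inter> (mpoly_component V (\<lambda>v. int (Poly_Mapping.lookup m v)) :: ('v, 'k) mpoly set)"
    using m by (auto simp: mpoly_component_def)
  then have "\<phi> (mon m) \<in> SR_component V \<Delta> (\<lambda>v. int (Poly_Mapping.lookup m v) + c v)"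
    using SR_Hom_componentD[OF \<phi>] by blast
  then obtain p where p: "p \<in> mpoly_component V (\<lambda>v. int (Poly_Mapping.lookup m v) + c v)" "\<phi> (mon m) = coset p"
    by (auto simp: SR_component_def)
  have "hcoef \<phi> m n = Poly_Mapping.lookup p n"
    unfolding hcoef_def using p n by (intro lookup_rep) (auto simp: mpoly_component_def)
  moreover have "n = shift V c m \<and> m \<in> admissible V \<Delta> c" if "Poly_Mapping.lookup p n \<noteq> 0"
  proof -
    have "int (Poly_Mapping.lookup n v) = int (Poly_Mapping.lookup m v) + c v" if "v \<in> V" for v
      using p(1) \<open>Poly_Mapping.lookup p n \<noteq> 0\<close> that by (auto simp: mpoly_component_def in_keys_iff)
    from admissible_iff[OF m n this] show ?thesis by blast
  qed
  ultimately show ?thesis by (auto simp: deg_coef_def)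
qed

lemma component_eqI:
  assumes "\<phi> \<in> SR_Hom_component V \<Delta> c" "\<psi> \<in> SR_Hom_component V \<Delta> c" "deg_coef c \<phi> = deg_coef c \<psi>"
  shows "\<phi> = \<psi>"
  using assms SR_Hom_component_subset by (intro SR_Hom_eqI) (auto simp: hcoef_component)

lemma hom_of_deg_coef:
  assumes "\<phi> \<in> SR_Hom_component V \<Delta> c"
  shows "hom_of c (deg_coef c \<phi>) = \<phi>"
proof -
  have "deg_coef c \<phi> \<in> hom_coeffs V \<Delta> c"
    using assms SR_Hom_component_subset by (intro deg_coef_hom_coeffs) auto
  then show ?thesis by (intro component_eqI[OF hom_of_component assms] deg_coef_hom_of)
qed

lemma deg_coef_add:
  assumes "\<phi> \<in> carrier (SR_Hom V \<Delta>)" "\<psi> \<in> carrier (SR_Hom V \<Delta>)"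
  shows "deg_coef c (\<phi> \<oplus>\<^bsub>SR_Hom V \<Delta>\<^esub> \<psi>) = (\<lambda>m. deg_coef c \<phi> m + deg_coef c \<psi> m)"
  using assms by (auto simp: deg_coef_def hcoef_add admissibleD)

lemma deg_coef_smult:
  assumes "\<phi> \<in> carrier (SR_Hom V \<Delta>)"
  shows "deg_coef c (Const k \<odot>\<^bsub>SR_Hom V \<Delta>\<^esub> \<phi>) = (\<lambda>m. k * deg_coef c \<phi> m)"
  using assms by (auto simp: deg_coef_def hcoef_smult admissibleD)

lemma hcoef_log_derivation:
  assumes "log_admissible V c \<alpha>"
    and "Poly_Mapping.keys m \<subseteq> V" "Poly_Mapping.keys m \<notin> \<Delta>" "Poly_Mapping.keys n \<in> \<Delta>"
  shows "hcoef (delta_star V \<Delta> (log_derivation V c \<alpha>)) m n = (if n = shift V c m then log_weight V \<alpha> m else 0)"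
  by (subst hcoef_delta_star[OF log_derivation_derivation[OF finite_V assms(1)] assms(2-4)])
    (auto simp: log_derivation_def lookup_single when_def)

lemma deg_coef_trivial:
  fixes \<phi> :: "('v, 'k::field) mpoly \<Rightarrow> ('v, 'k) mpoly set"
  assumes "\<phi> \<in> trivial_Homs"
  shows "deg_coef c \<phi> \<in> der_coeffs V \<Delta> c"
proof -
  obtain d where d: "d \<in> derivations V" "\<phi> = delta_star V \<Delta> d" using assms by blast
  let ?e = "\<lambda>w. Poly_Mapping.single w (1::nat)"
  define \<alpha> where "\<alpha> w = (if \<forall>v\<in>V. 0 \<le> (if v = w then 1 else 0) + c v
      then Poly_Mapping.lookup (d (mon (?e w))) (shift V c (?e w)) else 0)" for w
  have "deg_coef c \<phi> m = log_weight V \<alpha> m" if "m \<in> admissible V \<Delta> c" for m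
  proof -
    note adm = admissibleD[OF that]
    have "deg_coef c \<phi> m = Poly_Mapping.lookup (d (mon m)) (shift V c m)"
      using that d adm(1-3) by (simp add: deg_coef_def hcoef_delta_star)
    also have "\<dots> = (\<Sum>w\<in>V. of_nat (Poly_Mapping.lookup m w) *
        Poly_Mapping.lookup (mon (m - ?e w) * d (mon (?e w))) (shift V c m))"
      by (subst derivation_mon[OF d(1) finite_V adm(1)]) (simp add: lookup_sum)
    also have "\<dots> = (\<Sum>w\<in>V. of_nat (Poly_Mapping.lookup m w) * \<alpha> w)"
    proof (rule sum.cong[OF refl])
      fix w assume w: "w \<in> V"
      show "of_nat (Poly_Mapping.lookup m w) * Poly_Mapping.lookup (mon (m - ?e w) * d (mon (?e w))) (shift V c m)
         = of_nat (Poly_Mapping.lookup m w) * \<alpha> w"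
      proof (cases "Poly_Mapping.lookup m w = 0")
        case False
        have m: "(m - ?e w) + ?e w = m"
          using False by (intro poly_mapping_eqI) (auto simp: lookup_add lookup_minus lookup_single when_def)
        have "Poly_Mapping.lookup (mon (m - ?e w) * d (mon (?e w))) (shift V c m) = \<alpha> w"
        proof (cases "\<forall>v\<in>V. 0 \<le> (if v = w then 1 else 0) + c v")
          case True
          have "shift V c ((m - ?e w) + ?e w) = (m - ?e w) + shift V c (?e w)"
          proof (rule shift_add[OF finite_V])
            show "Poly_Mapping.keys (m - ?e w) \<subseteq> V" using adm(1) by (auto simp: in_keys_iff lookup_minus)
            show "0 \<le> int (Poly_Mapping.lookup (?e w) v) + c v" if "v \<in> V" for v
              using True that by (auto simp: lookup_single when_def split: if_splits)
          qed
          then show ?thesis using True unfolding m \<alpha>_def by simp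
        next
          case neg: False
          have "Poly_Mapping.lookup (mon (m - ?e w) * d (mon (?e w))) (shift V c m) = 0"
          proof (rule ccontr)
            assume "\<not> ?thesis"
            then obtain q where q: "shift V c m = (m - ?e w) + q" using lookup_mon_mult by blast
            have "0 \<le> (if v = w then 1 else 0) + c v" if "v \<in> V" for v
              using adm(5)[OF that] False unfolding q by (auto simp: lookup_add lookup_minus lookup_single when_def)
            with neg show False by blast
          qed
          moreover have "\<alpha> w = 0" unfolding \<alpha>_def using neg by (rule if_not_P)
          ultimately show ?thesis by simp
        qed
        then show ?thesis by simp
      qed simp
    qed
    finally show ?thesis by (simp add: log_weight_def)
  qed
  moreover have "log_admissible V c \<alpha>" by (auto simp: log_admissible_def \<alpha>_def)
  ultimately show ?thesis unfolding der_coeffs_def by blast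
qed

lemma component_trivial_iff:
  fixes \<phi> :: "('v, 'k::field) mpoly \<Rightarrow> ('v, 'k) mpoly set"
  assumes \<phi>: "\<phi> \<in> SR_Hom_component V \<Delta> c"
  shows "\<phi> \<in> trivial_Homs \<longleftrightarrow> deg_coef c \<phi> \<in> der_coeffs V \<Delta> c"
proof
  assume "deg_coef c \<phi> \<in> der_coeffs V \<Delta> c"
  then obtain \<alpha> where \<alpha>: "log_admissible V c \<alpha>" "\<And>m. m \<in> admissible V \<Delta> c \<Longrightarrow> deg_coef c \<phi> m = log_weight V \<alpha> m"
    unfolding der_coeffs_def by blast
  have "\<phi> = delta_star V \<Delta> (log_derivation V c \<alpha>)"
  proof (rule SR_Hom_eqI)
    show "\<phi> \<in> carrier (SR_Hom V \<Delta>)" using \<phi> SR_Hom_component_subset by blast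
    show "delta_star V \<Delta> (log_derivation V c \<alpha>) \<in> carrier (SR_Hom V \<Delta>)"
      by (intro delta_star_SR_Hom log_derivation_derivation finite_V \<alpha>)
    fix m n :: "'v \<Rightarrow>\<^sub>0 nat"
    assume *: "Poly_Mapping.keys m \<subseteq> V" "Poly_Mapping.keys m \<notin> \<Delta>" "Poly_Mapping.keys n \<in> \<Delta>"
    have "log_weight V \<alpha> m = deg_coef c \<phi> m" if n: "n = shift V c m"
    proof (cases "log_weight V \<alpha> m = 0 \<and> m \<notin> admissible V \<Delta> c")
      case True
      then show ?thesis by (simp add: deg_coef_def)
    next
      case False
      then have "m \<in> admissible V \<Delta> c"
        using log_admissibleD[OF \<alpha>(1), of m] * n by (auto simp: admissible_def)
      then show ?thesis using \<alpha>(2) by simp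
    qed
    then show "hcoef \<phi> m n = hcoef (delta_star V \<Delta> (log_derivation V c \<alpha>)) m n"
      by (simp add: hcoef_component[OF \<phi> *] hcoef_log_derivation[OF \<alpha>(1) *])
  qed
  then show "\<phi> \<in> trivial_Homs"
    using log_derivation_derivation[OF finite_V \<alpha>(1)] by blast
qed (rule deg_coef_trivial)

lemma zero_T1_component_coeffs:
  "zero_module (T1_component V \<Delta> c :: ('k::field, _) module) \<longleftrightarrow>
     hom_coeffs V \<Delta> c \<subseteq> (der_coeffs V \<Delta> c :: (('v \<Rightarrow>\<^sub>0 nat) \<Rightarrow> 'k) set)"
proof -
  let ?C = "SR_Hom_component V \<Delta> c :: (('v, 'k) mpoly \<Rightarrow> ('v, 'k) mpoly set) set"
  let ?L = "hom_coeffs V \<Delta> c :: (('v \<Rightarrow>\<^sub>0 nat) \<Rightarrow> 'k) set"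
  have "(\<lambda>_. 0) \<in> ?L" by (simp add: hom_coeffs_def)
  then have ne: "?C \<noteq> {}" using hom_of_component by (metis empty_iff)
  have "zero_module (T1_component V \<Delta> c :: ('k, _) module) \<longleftrightarrow> (\<forall>\<phi>\<in>?C. \<phi> \<in> trivial_Homs)"
    unfolding zero_T1_component_iff[OF ne] subset_eq ..
  also have "\<dots> \<longleftrightarrow> (\<forall>\<phi>\<in>?C. deg_coef c \<phi> \<in> der_coeffs V \<Delta> c)"
    by (rule ball_cong[OF refl component_trivial_iff])
  also have "\<dots> \<longleftrightarrow> (\<forall>l\<in>?L. l \<in> der_coeffs V \<Delta> c)"
  proof (intro iffI ballI)
    fix l assume *: "\<forall>\<phi>\<in>?C. deg_coef c \<phi> \<in> der_coeffs V \<Delta> c" and l: "l \<in> ?L"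
    from bspec[OF * hom_of_component[OF l]] show "l \<in> der_coeffs V \<Delta> c"
      unfolding deg_coef_hom_of[OF l] .
  next
    fix \<phi> assume *: "\<forall>l\<in>?L. l \<in> der_coeffs V \<Delta> c" and \<phi>: "\<phi> \<in> ?C"
    show "deg_coef c \<phi> \<in> der_coeffs V \<Delta> c"
      by (rule bspec[OF * deg_coef_hom_coeffs]) (rule subsetD[OF SR_Hom_component_subset \<phi>])
  qed
  finally show ?thesis by (simp only: subset_eq)
qed

lemma SR_Hom_component_iff:
  fixes \<phi> :: "('v, 'k::field) mpoly \<Rightarrow> ('v, 'k) mpoly set"
  shows "\<phi> \<in> SR_Hom_component V \<Delta> c \<longleftrightarrow> \<phi> \<in> carrier (SR_Hom V \<Delta>) \<and>
     (\<forall>m n. Poly_Mapping.keys m \<subseteq> V \<and> Poly_Mapping.keys m \<notin> \<Delta> \<and> Poly_Mapping.keys n \<in> \<Delta> \<longrightarrow>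
        hcoef \<phi> m n = (if n = shift V c m then deg_coef c \<phi> m else 0))" (is "_ \<longleftrightarrow> ?r")
proof
  assume "\<phi> \<in> SR_Hom_component V \<Delta> c"
  then show ?r using SR_Hom_component_subset by (auto simp: hcoef_component)
next
  assume r: ?r
  then have l: "deg_coef c \<phi> \<in> hom_coeffs V \<Delta> c" by (intro deg_coef_hom_coeffs) auto
  have "\<phi> = hom_of c (deg_coef c \<phi>)"
    using r by (intro SR_Hom_eqI hom_of_SR_Hom[OF l]) (simp_all add: hcoef_hom_of)
  then show "\<phi> \<in> SR_Hom_component V \<Delta> c" using hom_of_component[OF l] by simp
qed

lemma SR_Hom_component_add:
  assumes "\<phi> \<in> SR_Hom_component V \<Delta> c" "\<psi> \<in> SR_Hom_component V \<Delta> c"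
  shows "\<phi> \<oplus>\<^bsub>SR_Hom V \<Delta>\<^esub> \<psi> \<in> SR_Hom_component V \<Delta> c"
  using assms by (auto simp: SR_Hom_component_iff hcoef_add deg_coef_add)

lemma SR_Hom_component_smult:
  assumes "\<phi> \<in> SR_Hom_component V \<Delta> c"
  shows "Const k \<odot>\<^bsub>SR_Hom V \<Delta>\<^esub> \<phi> \<in> SR_Hom_component V \<Delta> c"
  using assms by (auto simp: SR_Hom_component_iff hcoef_smult deg_coef_smult)

lemma deg_coef_component:
  "\<phi> \<in> SR_Hom_component V \<Delta> c \<Longrightarrow> deg_coef c \<phi> \<in> hom_coeffs V \<Delta> c"
  by (rule deg_coef_hom_coeffs[OF subsetD[OF SR_Hom_component_subset]])

lemma T1_class_eq_coeffs:
  fixes \<phi> \<psi> :: "('v, 'k::field) mpoly \<Rightarrow> ('v, 'k) mpoly set"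
  assumes "\<phi> \<in> SR_Hom_component V \<Delta> c" "\<psi> \<in> SR_Hom_component V \<Delta> c"
  shows "T1_class \<phi> = T1_class \<psi> \<longleftrightarrow> (\<lambda>m. deg_coef c \<phi> m + (-1) * deg_coef c \<psi> m) \<in> der_coeffs V \<Delta> c"
proof -
  note carr = assms[THEN subsetD[OF SR_Hom_component_subset]]
  let ?\<chi> = "\<phi> \<oplus>\<^bsub>SR_Hom V \<Delta>\<^esub> (Const (-1) \<odot>\<^bsub>SR_Hom V \<Delta>\<^esub> \<psi>)"
  have "T1_class \<phi> = T1_class \<psi> \<longleftrightarrow> ?\<chi> \<in> trivial_Homs"
    by (rule T1_class_eq_iff[OF carr])
  also have "\<dots> \<longleftrightarrow> deg_coef c ?\<chi> \<in> der_coeffs V \<Delta> c"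
    by (intro component_trivial_iff SR_Hom_component_add SR_Hom_component_smult assms)
  also have "deg_coef c ?\<chi> = (\<lambda>m. deg_coef c \<phi> m + (-1) * deg_coef c \<psi> m)"
    by (simp only: deg_coef_add[OF carr(1) SR_Hom_smult[OF carr(2)]] deg_coef_smult[OF carr(2)])
  finally show ?thesis .
qed

lemma rigid_coeffs:
  "rigid TYPE('k::field) V \<Delta> \<longleftrightarrow>
     (\<forall>c. hom_coeffs V \<Delta> c \<subseteq> (der_coeffs V \<Delta> c :: (('v \<Rightarrow>\<^sub>0 nat) \<Rightarrow> 'k) set))"
proof (intro iffI allI subsetI)
  fix c and l :: "('v \<Rightarrow>\<^sub>0 nat) \<Rightarrow> 'k"
  assume rigid: "rigid TYPE('k) V \<Delta>" and l: "l \<in> hom_coeffs V \<Delta> c"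
  have "hom_of c l \<in> trivial_Homs"
    by (rule subsetD[OF rigid[unfolded rigid_iff] hom_of_SR_Hom[OF l]])
  from deg_coef_trivial[OF this, of c] show "l \<in> der_coeffs V \<Delta> c" unfolding deg_coef_hom_of[OF l] .
next
  assume *: "\<forall>c. hom_coeffs V \<Delta> c \<subseteq> (der_coeffs V \<Delta> c :: (('v \<Rightarrow>\<^sub>0 nat) \<Rightarrow> 'k) set)"
  show "rigid TYPE('k) V \<Delta>" unfolding rigid_iff
  proof
    fix \<phi> :: "('v, 'k) mpoly \<Rightarrow> ('v, 'k) mpoly set" assume \<phi>: "\<phi> \<in> carrier (SR_Hom V \<Delta>)"
    have "\<exists>\<alpha>. log_admissible V c \<alpha> \<and> (\<forall>m\<in>admissible V \<Delta> c. deg_coef c \<phi> m = log_weight V \<alpha> m)" for c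
      using * deg_coef_hom_coeffs[OF \<phi>, of c] unfolding der_coeffs_def by blast
    then obtain \<alpha> where \<alpha>: "\<And>c. log_admissible V c (\<alpha> c)"
      "\<And>c m. m \<in> admissible V \<Delta> c \<Longrightarrow> deg_coef c \<phi> m = log_weight V (\<alpha> c) m" by metis
    \<comment> \<open>The degrees that occur in the images of the squarefree generators of the ideal.\<close>
    let ?s = "\<lambda>N. \<Sum>v\<in>N. Poly_Mapping.single v (1::nat)"
    let ?deg = "\<lambda>m n v. if v \<in> V then int (Poly_Mapping.lookup n v) - int (Poly_Mapping.lookup m v) else 0"
    define C where "C = (\<Union>N\<in>Pow V. ?deg (?s N) ` Poly_Mapping.keys (rep \<phi> (mon (?s N))))"
    have finC: "finite C" unfolding C_def using finite_V by auto
    define d where "d f = (\<Sum>c\<in>C. log_derivation V c (\<alpha> c) f)" for f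
    have d: "d \<in> derivations V" unfolding d_def
      by (intro derivations_sum log_derivation_derivation finite_V \<alpha>)
    have "\<phi> = delta_star V \<Delta> d"
    proof (rule SR_Hom_eqI[OF \<phi> delta_star_SR_Hom[OF d]])
      fix m n :: "'v \<Rightarrow>\<^sub>0 nat"
      assume mn: "Poly_Mapping.keys m \<subseteq> V" "Poly_Mapping.keys m \<notin> \<Delta>" "Poly_Mapping.keys n \<in> \<Delta>"
      define c0 where "c0 = ?deg m n"
      have adm: "m \<in> admissible V \<Delta> c0" "n = shift V c0 m"
        using admissible_iff[OF mn, of c0] by (auto simp: c0_def)
      have coef0: "hcoef \<phi> m n = log_weight V (\<alpha> c0) m"
        using \<alpha>(2)[OF adm(1)] adm by (simp add: deg_coef_def)
      have "hcoef (delta_star V \<Delta> d) m n = (\<Sum>c\<in>C. Poly_Mapping.lookup (log_derivation V c (\<alpha> c) (mon m)) n)"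
        using hcoef_delta_star[OF d mn] by (simp add: d_def lookup_sum)
      also have "\<dots> = (\<Sum>c\<in>C. if c = c0 then log_weight V (\<alpha> c0) m else 0)"
      proof (rule sum.cong[OF refl])
        fix c assume c: "c \<in> C"
        have "c = c0" if n: "n = shift V c m" and w: "log_weight V (\<alpha> c) m \<noteq> 0"
        proof
          fix v show "c v = c0 v"
          proof (cases "v \<in> V")
            case True
            then show ?thesis
              using lookup_shift_int[where c = c and m = m, OF finite_V True log_admissibleD[OF \<alpha>(1) w True]] n
              by (simp add: c0_def)
          next
            case False
            then show ?thesis using c by (auto simp: C_def c0_def)
          qed
        qed
        then show "Poly_Mapping.lookup (log_derivation V c (\<alpha> c) (mon m)) n = (if c = c0 then log_weight V (\<alpha> c0) m else 0)"
          using adm(2) by (auto simp: log_derivation_def lookup_single when_def)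
      qed
      also have "\<dots> = (if c0 \<in> C then log_weight V (\<alpha> c0) m else 0)"
        using finC by simp
      also have "\<dots> = hcoef \<phi> m n"
      proof (cases "hcoef \<phi> m n = 0")
        case False
        let ?N = "Poly_Mapping.keys m"
        let ?u = "m - ?s ?N"
        have fin: "finite ?N" by simp
        have u: "Poly_Mapping.keys ?u \<subseteq> V" using mn(1) by (auto simp: in_keys_iff lookup_minus)
        have decomp: "?u + ?s ?N = m" using squarefree_decomp[of m] by simp
        have eq: "hcoef \<phi> m n = Poly_Mapping.lookup (mon ?u * rep \<phi> (mon (?s ?N))) n"
          using hcoef_add_exponent[OF \<phi> _ _ u mn(3), of "?s ?N"] mn keys_squarefree[OF fin] decomp by metis
        then obtain q where q: "n = ?u + q" using False lookup_mon_mult by metis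
        have "Poly_Mapping.lookup (rep \<phi> (mon (?s ?N))) q \<noteq> 0"
          using False unfolding eq by (simp only: q lookup_mon_mult_add not_False_eq_True)
        moreover have "c0 = ?deg (?s ?N) q"
        proof
          fix v
          have "Poly_Mapping.lookup n v = Poly_Mapping.lookup ?u v + Poly_Mapping.lookup q v"
            unfolding q by (rule lookup_add)
          moreover have "Poly_Mapping.lookup m v = Poly_Mapping.lookup ?u v + Poly_Mapping.lookup (?s ?N) v"
            by (subst decomp[symmetric]) (rule lookup_add)
          ultimately show "c0 v = ?deg (?s ?N) q v" by (simp add: c0_def)
        qed
        ultimately have "c0 \<in> C" using mn(1) unfolding C_def in_keys_iff[symmetric] by blast
        then show ?thesis using coef0 by simp
      qed (use coef0 in simp)
      finally show "hcoef \<phi> m n = hcoef (delta_star V \<Delta> d) m n" ..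
    qed
    then show "\<phi> \<in> trivial_Homs" using d by blast
  qed
qed

end

lemma T1_component_isoI:
  fixes \<theta> :: "(('v \<Rightarrow>\<^sub>0 nat) \<Rightarrow> 'k::field) \<Rightarrow> (('w \<Rightarrow>\<^sub>0 nat) \<Rightarrow> 'k)"
  assumes "simplicial_complex V \<Delta>" "simplicial_complex V' \<Delta>'"
    and bij: "bij_betw \<theta> (hom_coeffs V \<Delta> c) (hom_coeffs V' \<Delta>' c')"
    and add: "\<And>l l'. \<theta> (\<lambda>m. l m + l' m) = (\<lambda>m. \<theta> l m + \<theta> l' m)"
    and smult: "\<And>k l. \<theta> (\<lambda>m. k * l m) = (\<lambda>m. k * \<theta> l m)"
    and der: "\<And>l. l \<in> hom_coeffs V \<Delta> c \<Longrightarrow> \<theta> l \<in> der_coeffs V' \<Delta>' c' \<longleftrightarrow> l \<in> der_coeffs V \<Delta> c"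
  shows "module_iso class_ring (T1_component V \<Delta> c :: ('k, _) module) (T1_component V' \<Delta>' c')"
proof -
  interpret A: complex V \<Delta> by (rule complex.intro) fact
  interpret B: complex V' \<Delta>' by (rule complex.intro) fact
  let ?C = "SR_Hom_component V \<Delta> c :: (('v, 'k) mpoly \<Rightarrow> ('v, 'k) mpoly set) set"
  let ?C' = "SR_Hom_component V' \<Delta>' c' :: (('w, 'k) mpoly \<Rightarrow> ('w, 'k) mpoly set) set"
  let ?H = "SR_Hom V \<Delta> :: (('v, 'k) mpoly, _) module"
  let ?H' = "SR_Hom V' \<Delta>' :: (('w, 'k) mpoly, _) module"
  note carr = subsetD[OF A.SR_Hom_component_subset] and carr' = subsetD[OF B.SR_Hom_component_subset]
  define F where "F \<phi> = B.hom_of c' (\<theta> (A.deg_coef c \<phi>))" for \<phi> :: "('v, 'k) mpoly \<Rightarrow> ('v, 'k) mpoly set"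
  have \<theta>: "\<theta> l \<in> hom_coeffs V' \<Delta>' c'" if "l \<in> hom_coeffs V \<Delta> c" for l
    using bij_betwE[OF bij] that by blast
  have F: "F \<phi> \<in> ?C'" and deg_F: "B.deg_coef c' (F \<phi>) = \<theta> (A.deg_coef c \<phi>)" if "\<phi> \<in> ?C" for \<phi>
    unfolding F_def by (intro B.hom_of_component B.deg_coef_hom_of \<theta> A.deg_coef_component that)+
  have F_add: "F (\<phi> \<oplus>\<^bsub>?H\<^esub> \<psi>) = F \<phi> \<oplus>\<^bsub>?H'\<^esub> F \<psi>" if "\<phi> \<in> ?C" "\<psi> \<in> ?C" for \<phi> \<psi>
  proof (rule B.component_eqI)
    show "F (\<phi> \<oplus>\<^bsub>?H\<^esub> \<psi>) \<in> ?C'" "F \<phi> \<oplus>\<^bsub>?H'\<^esub> F \<psi> \<in> ?C'"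
      by (intro F A.SR_Hom_component_add B.SR_Hom_component_add that)+
    show "B.deg_coef c' (F (\<phi> \<oplus>\<^bsub>?H\<^esub> \<psi>)) = B.deg_coef c' (F \<phi> \<oplus>\<^bsub>?H'\<^esub> F \<psi>)"
      by (simp only: deg_F[OF A.SR_Hom_component_add[OF that]] A.deg_coef_add[OF carr[OF that(1)] carr[OF that(2)]]
        B.deg_coef_add[OF carr'[OF F[OF that(1)]] carr'[OF F[OF that(2)]]] deg_F[OF that(1)] deg_F[OF that(2)] add)
  qed
  have F_smult: "F (Const k \<odot>\<^bsub>?H\<^esub> \<phi>) = Const k \<odot>\<^bsub>?H'\<^esub> F \<phi>" if "\<phi> \<in> ?C" for \<phi> k
  proof (rule B.component_eqI)
    show "F (Const k \<odot>\<^bsub>?H\<^esub> \<phi>) \<in> ?C'" "Const k \<odot>\<^bsub>?H'\<^esub> F \<phi> \<in> ?C'"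
      by (intro F A.SR_Hom_component_smult B.SR_Hom_component_smult that)+
    show "B.deg_coef c' (F (Const k \<odot>\<^bsub>?H\<^esub> \<phi>)) = B.deg_coef c' (Const k \<odot>\<^bsub>?H'\<^esub> F \<phi>)"
      by (simp only: deg_F[OF A.SR_Hom_component_smult[OF that]] A.deg_coef_smult[OF carr[OF that]]
        B.deg_coef_smult[OF carr'[OF F[OF that]]] deg_F[OF that] smult)
  qed
  have F_class: "B.T1_class (F \<phi>) = B.T1_class (F \<psi>) \<longleftrightarrow> A.T1_class \<phi> = A.T1_class \<psi>"
    if "\<phi> \<in> ?C" "\<psi> \<in> ?C" for \<phi> \<psi>
  proof -
    let ?l = "\<lambda>m. A.deg_coef c \<phi> m + (-1) * A.deg_coef c \<psi> m"
    have "?l = A.deg_coef c (\<phi> \<oplus>\<^bsub>?H\<^esub> (Const (-1) \<odot>\<^bsub>?H\<^esub> \<psi>))"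
      by (simp only: A.deg_coef_add[OF carr[OF that(1)] A.SR_Hom_smult[OF carr[OF that(2)]]]
        A.deg_coef_smult[OF carr[OF that(2)]])
    also have "\<dots> \<in> hom_coeffs V \<Delta> c"
      by (intro A.deg_coef_component A.SR_Hom_component_add A.SR_Hom_component_smult that)
    finally have l: "?l \<in> hom_coeffs V \<Delta> c" .
    have "\<theta> ?l = (\<lambda>m. \<theta> (A.deg_coef c \<phi>) m + (-1) * \<theta> (A.deg_coef c \<psi>) m)"
      unfolding add[of "A.deg_coef c \<phi>" "\<lambda>m. (-1) * A.deg_coef c \<psi> m"] smult ..
    then show ?thesis
      using der[OF l] unfolding A.T1_class_eq_coeffs[OF that] B.T1_class_eq_coeffs[OF F[OF that(1)] F[OF that(2)]]
        deg_F[OF that(1)] deg_F[OF that(2)] by (simp only:)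
  qed
  define h where "h X = B.T1_class (F (SOME \<phi>. \<phi> \<in> ?C \<and> A.T1_class \<phi> = X))" for X
  have h: "h (A.T1_class \<phi>) = B.T1_class (F \<phi>)" if "\<phi> \<in> ?C" for \<phi>
  proof -
    let ?\<psi> = "SOME \<psi>. \<psi> \<in> ?C \<and> A.T1_class \<psi> = A.T1_class \<phi>"
    have "?\<psi> \<in> ?C \<and> A.T1_class ?\<psi> = A.T1_class \<phi>"
      by (rule someI[of _ \<phi>]) (simp add: that)
    then show ?thesis unfolding h_def using F_class[OF _ that] by blast
  qed
  have "bij_betw h (A.T1_class ` ?C) (B.T1_class ` ?C')"
  proof (rule bij_betwI')
    fix X Y assume "X \<in> A.T1_class ` ?C" "Y \<in> A.T1_class ` ?C"
    then obtain \<phi> \<psi> where *: "X = A.T1_class \<phi>" "\<phi> \<in> ?C" "Y = A.T1_class \<psi>" "\<psi> \<in> ?C" by (elim imageE)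
    show "h X = h Y \<longleftrightarrow> X = Y"
      unfolding *(1,3) h[OF *(2)] h[OF *(4)] by (rule F_class[OF *(2,4)])
  next
    fix X assume "X \<in> A.T1_class ` ?C"
    then obtain \<phi> where *: "X = A.T1_class \<phi>" "\<phi> \<in> ?C" by (elim imageE)
    show "h X \<in> B.T1_class ` ?C'"
      unfolding *(1) h[OF *(2)] by (rule imageI[OF F[OF *(2)]])
  next
    fix Y assume "Y \<in> B.T1_class ` ?C'"
    then obtain \<psi> where \<psi>: "Y = B.T1_class \<psi>" "\<psi> \<in> ?C'" by (elim imageE)
    obtain l where l: "l \<in> hom_coeffs V \<Delta> c" "\<theta> l = B.deg_coef c' \<psi>"
      using bij_betw_imp_surj_on[OF bij] B.deg_coef_component[OF \<psi>(2)] by (metis imageE)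
    have in_C: "A.hom_of c l \<in> ?C" by (rule A.hom_of_component[OF l(1)])
    have "F (A.hom_of c l) = \<psi>"
      unfolding F_def A.deg_coef_hom_of[OF l(1)] l(2) by (rule B.hom_of_deg_coef[OF \<psi>(2)])
    then have "Y = h (A.T1_class (A.hom_of c l))" unfolding h[OF in_C] \<psi>(1) by simp
    then show "\<exists>X\<in>A.T1_class ` ?C. Y = h X" using imageI[OF in_C] by (intro bexI)
  qed
  moreover have "h \<in> module_hom class_ring (T1_component V \<Delta> c :: ('k, _) module) (T1_component V' \<Delta>' c')"
    unfolding LinearCombinations.module_hom_def A.T1_component_simps B.T1_component_simps
  proof (intro CollectI conjI allI impI)
    show "h \<in> A.T1_class ` ?C \<rightarrow> B.T1_class ` ?C'"
      by (rule bij_betw_imp_funcset) fact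
    fix X Y assume "X \<in> A.T1_class ` ?C \<and> Y \<in> A.T1_class ` ?C"
    then obtain \<phi> \<psi> where *: "X = A.T1_class \<phi>" "\<phi> \<in> ?C" "Y = A.T1_class \<psi>" "\<psi> \<in> ?C" by (elim conjE imageE)
    show "h (X \<oplus>\<^bsub>T1 V \<Delta>\<^esub> Y) = h X \<oplus>\<^bsub>T1 V' \<Delta>'\<^esub> h Y"
      by (simp only: *(1,3) h[OF *(2)] h[OF *(4)] A.T1_class_add[OF carr[OF *(2)] carr[OF *(4)]]
        B.T1_class_add[OF carr'[OF F[OF *(2)]] carr'[OF F[OF *(4)]]] h[OF A.SR_Hom_component_add[OF *(2,4)]] F_add[OF *(2,4)])
  next
    fix k :: 'k and X assume "k \<in> carrier class_ring \<and> X \<in> A.T1_class ` ?C"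
    then obtain \<phi> where *: "X = A.T1_class \<phi>" "\<phi> \<in> ?C" by (elim conjE imageE)
    show "h (k \<odot>\<^bsub>T1 V \<Delta>\<^esub> X) = k \<odot>\<^bsub>T1 V' \<Delta>'\<^esub> h X"
      by (simp only: *(1) h[OF *(2)] A.T1_class_smult[OF carr[OF *(2)]] B.T1_class_smult[OF carr'[OF F[OF *(2)]]]
        h[OF A.SR_Hom_component_smult[OF *(2)]] F_smult[OF *(2)])
  qed
  ultimately show ?thesis
    unfolding module_iso_def A.T1_component_simps B.T1_component_simps by (intro bexI)
qed

section \<open>Joins\<close>

lemma simplicial_join_commute: "simplicial_join \<Delta>1 \<Delta>2 = simplicial_join \<Delta>2 \<Delta>1"
  unfolding simplicial_join_def by (metis Un_commute)

lemma der_coeffsI_zero: "(\<And>m. m \<in> admissible V \<Delta> c \<Longrightarrow> l m = 0) \<Longrightarrow> l \<in> der_coeffs V \<Delta> c"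
  unfolding der_coeffs_def
  by (intro CollectI exI[of _ "\<lambda>_. 0"]) (simp add: log_admissible_def log_weight_def)

abbreviation exponent_restrict :: "'v set \<Rightarrow> ('v \<Rightarrow>\<^sub>0 nat) \<Rightarrow> ('v \<Rightarrow>\<^sub>0 nat)" where
  "exponent_restrict E \<equiv> shift E (\<lambda>_. 0)"

locale complex_join = A: complex E1 \<Delta>1 + B: complex E2 \<Delta>2
  for E1 E2 :: "'v set" and \<Delta>1 \<Delta>2 +
  assumes disjoint: "E1 \<inter> E2 = {}"
begin

abbreviation "E \<equiv> E1 \<union> E2"
abbreviation "J \<equiv> simplicial_join \<Delta>1 \<Delta>2"

lemma join_iff: "F \<in> J \<longleftrightarrow> F \<subseteq> E \<and> F \<inter> E1 \<in> \<Delta>1 \<and> F \<inter> E2 \<in> \<Delta>2"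
proof
  assume "F \<in> J"
  then obtain G H where *: "F = G \<union> H" "G \<in> \<Delta>1" "H \<in> \<Delta>2" by (auto simp: simplicial_join_def)
  have "G \<subseteq> E1" "H \<subseteq> E2" using * A.faces_subset B.faces_subset by auto
  then have "F \<subseteq> E" "F \<inter> E1 = G" "F \<inter> E2 = H" using * disjoint by auto
  then show "F \<subseteq> E \<and> F \<inter> E1 \<in> \<Delta>1 \<and> F \<inter> E2 \<in> \<Delta>2" using * by simp
next
  assume *: "F \<subseteq> E \<and> F \<inter> E1 \<in> \<Delta>1 \<and> F \<inter> E2 \<in> \<Delta>2"
  then have "F = (F \<inter> E1) \<union> (F \<inter> E2)" by blast
  then show "F \<in> J" using * unfolding simplicial_join_def by blast
qed

sublocale J: complex E J
proof
  show "simplicial_complex E J"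
    unfolding simplicial_complex_def
  proof (intro conjI ballI allI impI)
    show "finite E" using A.finite_V B.finite_V by simp
    show "J \<subseteq> Pow E" using join_iff by blast
    show "{} \<in> J" using A.empty_face B.empty_face by (simp add: join_iff)
    fix F G assume F: "F \<in> J" and G: "G \<subseteq> F"
    have "G \<inter> E1 \<in> \<Delta>1"
      by (rule A.face_mono[of "F \<inter> E1"]) (use F G in \<open>auto simp: join_iff\<close>)
    moreover have "G \<inter> E2 \<in> \<Delta>2"
      by (rule B.face_mono[of "F \<inter> E2"]) (use F G in \<open>auto simp: join_iff\<close>)
    ultimately show "G \<in> J" using F G unfolding join_iff by blast
  qed
qed

lemma lookup_restrict: "Poly_Mapping.lookup (exponent_restrict E1 m) v = (if v \<in> E1 then Poly_Mapping.lookup m v else 0)"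
  by (simp add: lookup_shift[OF A.finite_V])

lemma keys_restrict: "Poly_Mapping.keys (exponent_restrict E1 m) = Poly_Mapping.keys m \<inter> E1"
  by (auto simp: in_keys_iff lookup_restrict split: if_splits)

lemma restrict_id: "Poly_Mapping.keys m \<subseteq> E1 \<Longrightarrow> exponent_restrict E1 m = m"
  by (rule poly_mapping_eqI) (auto simp: lookup_restrict in_keys_iff)

lemma restrict_add: "exponent_restrict E1 (m + u) = exponent_restrict E1 m + exponent_restrict E1 u"
  by (rule poly_mapping_eqI) (simp add: lookup_restrict lookup_add)

lemma restrict_decomp: "exponent_restrict E1 m + (m - exponent_restrict E1 m) = m"
  by (rule poly_mapping_eqI) (simp add: lookup_restrict lookup_add lookup_minus)

lemma hom_coeffs_restrict:
  assumes l: "l \<in> hom_coeffs E J c" and m: "m \<in> admissible E J c" "Poly_Mapping.keys m \<inter> E1 \<notin> \<Delta>1"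
  shows "l m = l (exponent_restrict E1 m)"
proof -
  let ?r = "exponent_restrict E1 m"
  have "Poly_Mapping.keys ?r \<subseteq> E \<and> Poly_Mapping.keys ?r \<notin> J \<and> ?r + (m - ?r) \<in> admissible E J c"
    using m by (auto simp: keys_restrict join_iff restrict_decomp)
  then have "l (?r + (m - ?r)) = l ?r" using l unfolding hom_coeffs_def by blast
  then show ?thesis by (simp add: restrict_decomp)
qed

lemma hom_coeffs_neg_right:
  assumes l: "l \<in> hom_coeffs E J c" and m: "Poly_Mapping.keys m \<inter> E1 \<notin> \<Delta>1"
    and v: "v \<in> E2" "c v < 0"
  shows "l m = 0"
proof (rule ccontr)
  assume nz: "l m \<noteq> 0"
  have supp: "m \<in> admissible E J c" if "l m \<noteq> 0" for m using l that unfolding hom_coeffs_def by blast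
  have "l (exponent_restrict E1 m) \<noteq> 0"
    using hom_coeffs_restrict[OF l supp[OF nz] m] nz by simp
  from J.admissibleD(4)[OF supp[OF this], of v] v disjoint show False
    by (auto simp: lookup_restrict split: if_splits)
qed

lemma pos_part_nonface_trivial:
  assumes "{v \<in> E. 0 < c v} \<notin> J"
  shows "l \<in> der_coeffs E J c"
proof (rule der_coeffsI_zero)
  fix m assume m: "m \<in> admissible E J c"
  have "{v \<in> E. 0 < c v} \<subseteq> Poly_Mapping.keys (shift E c m)"
    by (auto simp: in_keys_iff lookup_shift[OF J.finite_V])
  then show "l m = 0" using J.face_mono J.admissibleD(3)[OF m] assms by blast
qed

context
  fixes c c1 :: "'v \<Rightarrow> int"
  assumes c1: "\<And>v. v \<in> E1 \<Longrightarrow> c v = c1 v"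
    and nonneg: "\<And>v. v \<in> E2 \<Longrightarrow> 0 \<le> c v"
    and face: "{v \<in> E2. c v \<noteq> 0} \<in> \<Delta>2"
begin

lemma keys_shift_left: "Poly_Mapping.keys (shift E c m) \<inter> E1 = Poly_Mapping.keys (shift E1 c1 (exponent_restrict E1 m))"
  by (auto simp: in_keys_iff lookup_shift[OF J.finite_V] lookup_shift[OF A.finite_V] c1 split: if_splits)

lemma keys_shift_right: "Poly_Mapping.keys (shift E c m) \<inter> E2 = (Poly_Mapping.keys m \<inter> E2) \<union> {v \<in> E2. c v \<noteq> 0}"
  using nonneg by (force simp: in_keys_iff lookup_shift[OF J.finite_V] split: if_splits)

lemma admissible_right_face:
  "m \<in> admissible E J c \<Longrightarrow> Poly_Mapping.keys m \<inter> E2 \<in> \<Delta>2"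
  using J.admissibleD(3)[of m c] B.face_mono unfolding join_iff keys_shift_right by blast

lemma admissible_restrict:
  assumes "m \<in> admissible E J c"
  shows "exponent_restrict E1 m \<in> admissible E1 \<Delta>1 c1" "Poly_Mapping.keys m \<inter> E1 \<notin> \<Delta>1"
proof -
  note adm = J.admissibleD[OF assms]
  show nf: "Poly_Mapping.keys m \<inter> E1 \<notin> \<Delta>1"
    using adm(1,2) admissible_right_face[OF assms] by (simp add: join_iff)
  have "Poly_Mapping.keys (shift E1 c1 (exponent_restrict E1 m)) \<in> \<Delta>1"
    using adm(3) unfolding join_iff keys_shift_left by blast
  moreover have "0 \<le> int (Poly_Mapping.lookup (exponent_restrict E1 m) v) + c1 v" if "v \<in> E1" for v
    using adm(4)[of v] that by (simp add: lookup_restrict c1)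
  ultimately show "exponent_restrict E1 m \<in> admissible E1 \<Delta>1 c1"
    using nf by (simp add: admissible_def keys_restrict)
qed

lemma admissibleI_restrict:
  assumes "exponent_restrict E1 m \<in> admissible E1 \<Delta>1 c1" "Poly_Mapping.keys m \<subseteq> E"
    "Poly_Mapping.keys (shift E c m) \<inter> E2 \<in> \<Delta>2"
  shows "m \<in> admissible E J c"
proof -
  note adm = A.admissibleD[OF assms(1)]
  have "Poly_Mapping.keys m \<notin> J" using adm(2) by (simp add: join_iff keys_restrict)
  moreover have "0 \<le> int (Poly_Mapping.lookup m v) + c v" if "v \<in> E" for v
    using adm(4)[of v] that nonneg[of v] by (auto simp: lookup_restrict c1)
  moreover have "Poly_Mapping.keys (shift E c m) \<in> J"
    using adm(3) assms(3) keys_shift[OF J.finite_V] by (simp add: join_iff keys_shift_left)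
  ultimately show ?thesis using assms(2) by (simp add: admissible_def)
qed

lemma admissible_left_iff:
  assumes "Poly_Mapping.keys m \<subseteq> E1"
  shows "m \<in> admissible E J c \<longleftrightarrow> m \<in> admissible E1 \<Delta>1 c1"
proof
  assume "m \<in> admissible E J c"
  then show "m \<in> admissible E1 \<Delta>1 c1" using admissible_restrict(1)[of m] restrict_id[OF assms] by simp
next
  assume m: "m \<in> admissible E1 \<Delta>1 c1"
  have "Poly_Mapping.keys m \<inter> E2 = {}" using assms disjoint by blast
  then have "Poly_Mapping.keys (shift E c m) \<inter> E2 \<in> \<Delta>2" using face by (simp add: keys_shift_right)
  then show "m \<in> admissible E J c" using m assms by (intro admissibleI_restrict) (auto simp: restrict_id)
qed

definition left_coeffs :: "(('v \<Rightarrow>\<^sub>0 nat) \<Rightarrow> 'k) \<Rightarrow> ('v \<Rightarrow>\<^sub>0 nat) \<Rightarrow> 'k::field" where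
  "left_coeffs l m = (if m \<in> admissible E1 \<Delta>1 c1 then l m else 0)"

lemma left_coeffs_restrict:
  assumes "l \<in> hom_coeffs E J c" "m \<in> admissible E J c"
  shows "l m = left_coeffs l (exponent_restrict E1 m)"
  using hom_coeffs_restrict[OF assms admissible_restrict(2)[OF assms(2)]] admissible_restrict(1)[OF assms(2)]
  by (simp add: left_coeffs_def)

lemma left_coeffs_hom_coeffs:
  assumes l: "l \<in> hom_coeffs E J c"
  shows "left_coeffs l \<in> hom_coeffs E1 \<Delta>1 c1"
  unfolding hom_coeffs_def
proof (intro CollectI conjI allI impI)
  fix m u :: "'v \<Rightarrow>\<^sub>0 nat"
  assume *: "Poly_Mapping.keys m \<subseteq> E1 \<and> Poly_Mapping.keys m \<notin> \<Delta>1 \<and> m + u \<in> admissible E1 \<Delta>1 c1"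
  then have "m + u \<in> admissible E J c" using admissible_left_iff A.admissibleD(1) by blast
  moreover have "Poly_Mapping.keys m \<subseteq> E \<and> Poly_Mapping.keys m \<notin> J"
    using * by (auto simp: join_iff Int_absorb2)
  ultimately have "l (m + u) = l m" using l unfolding hom_coeffs_def by blast
  moreover have "l m = 0" if "m \<notin> admissible E1 \<Delta>1 c1"
    using that l admissible_left_iff * unfolding hom_coeffs_def by blast
  ultimately show "left_coeffs l (m + u) = left_coeffs l m" using * by (simp add: left_coeffs_def)
qed (auto simp: left_coeffs_def split: if_splits)

lemma left_coeffs_surj:
  assumes l1: "l1 \<in> hom_coeffs E1 \<Delta>1 c1"
  shows "\<exists>l \<in> hom_coeffs E J c. left_coeffs l = l1"
proof
  define l where "l m = (if m \<in> admissible E J c then l1 (exponent_restrict E1 m) else 0)" for m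
  show "left_coeffs l = l1"
  proof
    fix m show "left_coeffs l m = l1 m"
    proof (cases "m \<in> admissible E1 \<Delta>1 c1")
      case True
      then show ?thesis using A.admissibleD(1)[OF True] admissible_left_iff
        by (simp add: left_coeffs_def l_def restrict_id)
    next
      case False
      then show ?thesis using l1 unfolding left_coeffs_def hom_coeffs_def by auto
    qed
  qed
  show "l \<in> hom_coeffs E J c" unfolding hom_coeffs_def
  proof (intro CollectI conjI allI impI)
    fix m u :: "'v \<Rightarrow>\<^sub>0 nat"
    assume *: "Poly_Mapping.keys m \<subseteq> E \<and> Poly_Mapping.keys m \<notin> J \<and> m + u \<in> admissible E J c"
    let ?r = "exponent_restrict E1"
    have mu: "m + u \<in> admissible E J c" using * by blast
    have right: "Poly_Mapping.keys (shift E c m) \<inter> E2 \<in> \<Delta>2"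
    proof (rule B.face_mono)
      show "Poly_Mapping.keys (shift E c (m + u)) \<inter> E2 \<in> \<Delta>2"
        using J.admissibleD(3)[OF mu] unfolding join_iff by blast
      show "Poly_Mapping.keys (shift E c m) \<inter> E2 \<subseteq> Poly_Mapping.keys (shift E c (m + u)) \<inter> E2"
        unfolding keys_shift_right keys_nat_add by blast
    qed
    have "Poly_Mapping.keys m \<inter> E2 \<in> \<Delta>2"
      using right B.face_mono unfolding keys_shift_right by blast
    then have "Poly_Mapping.keys (?r m) \<subseteq> E1 \<and> Poly_Mapping.keys (?r m) \<notin> \<Delta>1 \<and> ?r m + ?r u \<in> admissible E1 \<Delta>1 c1"
      using * admissible_restrict(1)[OF mu] by (auto simp: keys_restrict join_iff restrict_add)
    then have eq: "l1 (?r (m + u)) = l1 (?r m)" using l1 unfolding hom_coeffs_def restrict_add by blast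
    have "l1 (?r m) = 0" if "m \<notin> admissible E J c"
      using that admissibleI_restrict[OF _ _ right] * l1 unfolding hom_coeffs_def by blast
    then show "l (m + u) = l m" using mu eq by (simp add: l_def)
  qed (auto simp: l_def split: if_splits)
qed

lemma bij_left_coeffs:
  "bij_betw left_coeffs (hom_coeffs E J c) (hom_coeffs E1 \<Delta>1 c1 :: (('v \<Rightarrow>\<^sub>0 nat) \<Rightarrow> 'k::field) set)"
  unfolding bij_betw_def
proof
  show "inj_on left_coeffs (hom_coeffs E J c :: (('v \<Rightarrow>\<^sub>0 nat) \<Rightarrow> 'k::field) set)"
  proof (rule inj_onI, rule ext)
    fix l l' :: "('v \<Rightarrow>\<^sub>0 nat) \<Rightarrow> 'k" and m
    assume *: "l \<in> hom_coeffs E J c" "l' \<in> hom_coeffs E J c" "left_coeffs l = left_coeffs l'"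
    show "l m = l' m"
    proof (cases "m \<in> admissible E J c")
      case True
      show ?thesis unfolding left_coeffs_restrict[OF *(1) True] left_coeffs_restrict[OF *(2) True] *(3) ..
    next
      case False
      then show ?thesis using *(1,2) unfolding hom_coeffs_def by (metis (mono_tags, lifting) mem_Collect_eq)
    qed
  qed
  show "left_coeffs ` hom_coeffs E J c = (hom_coeffs E1 \<Delta>1 c1 :: (('v \<Rightarrow>\<^sub>0 nat) \<Rightarrow> 'k::field) set)"
    using left_coeffs_hom_coeffs left_coeffs_surj by (auto simp: image_iff)
qed

lemma left_coeffs_der_coeffs_iff:
  fixes l :: "('v \<Rightarrow>\<^sub>0 nat) \<Rightarrow> 'k::field"
  assumes l: "l \<in> hom_coeffs E J c"
  shows "left_coeffs l \<in> der_coeffs E1 \<Delta>1 c1 \<longleftrightarrow> l \<in> der_coeffs E J c"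
proof
  assume "left_coeffs l \<in> der_coeffs E1 \<Delta>1 c1"
  then obtain \<alpha> where \<alpha>: "log_admissible E1 c1 \<alpha>"
    "\<And>m. m \<in> admissible E1 \<Delta>1 c1 \<Longrightarrow> left_coeffs l m = log_weight E1 \<alpha> m" unfolding der_coeffs_def by blast
  let ?\<beta> = "\<lambda>v. if v \<in> E1 then \<alpha> v else 0"
  have "log_admissible E c ?\<beta>"
    unfolding log_admissible_def
  proof (intro ballI impI)
    fix w v assume w: "w \<in> E" "?\<beta> w \<noteq> 0" and v: "v \<in> E"
    show "0 \<le> (if v = w then 1 else 0) + c v"
    proof (cases "v \<in> E1")
      case True
      then show ?thesis using w \<alpha>(1) c1[OF True] unfolding log_admissible_def by (auto split: if_splits)
    next
      case False
      then show ?thesis using v nonneg[of v] by auto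
    qed
  qed
  moreover have "l m = log_weight E ?\<beta> m" if m: "m \<in> admissible E J c" for m
  proof -
    have "l m = log_weight E1 \<alpha> (exponent_restrict E1 m)"
      unfolding left_coeffs_restrict[OF l m] by (rule \<alpha>(2)[OF admissible_restrict(1)[OF m]])
    also have "\<dots> = (\<Sum>w\<in>E1. of_nat (Poly_Mapping.lookup m w) * ?\<beta> w)"
      unfolding log_weight_def by (rule sum.cong) (simp_all add: lookup_restrict)
    also have "\<dots> = log_weight E ?\<beta> m"
      unfolding log_weight_def by (rule sum.mono_neutral_left) (use A.finite_V B.finite_V in auto)
    finally show ?thesis .
  qed
  ultimately show "l \<in> der_coeffs E J c" unfolding der_coeffs_def by blast
next
  assume "l \<in> der_coeffs E J c"
  then obtain \<alpha> where \<alpha>: "log_admissible E c \<alpha>"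
    "\<And>m. m \<in> admissible E J c \<Longrightarrow> l m = log_weight E \<alpha> m" unfolding der_coeffs_def by blast
  have "log_admissible E1 c1 \<alpha>"
    unfolding log_admissible_def
  proof (intro ballI impI)
    fix w v assume *: "w \<in> E1" "\<alpha> w \<noteq> 0" "v \<in> E1"
    then have "0 \<le> (if v = w then 1 else 0) + c v"
      using \<alpha>(1) unfolding log_admissible_def by blast
    then show "0 \<le> (if v = w then 1 else 0) + c1 v" unfolding c1[OF *(3)] .
  qed
  moreover have "left_coeffs l m = log_weight E1 \<alpha> m" if m: "m \<in> admissible E1 \<Delta>1 c1" for m
  proof -
    note adm = A.admissibleD(1)[OF m]
    have zero: "Poly_Mapping.lookup m w = 0" if "w \<notin> E1" for w
      using adm that by (auto simp: in_keys_iff)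
    have "left_coeffs l m = log_weight E \<alpha> m"
      using \<alpha>(2)[of m] m admissible_left_iff[OF adm] by (simp add: left_coeffs_def)
    also have "\<dots> = log_weight E1 \<alpha> m"
      unfolding log_weight_def
      by (rule sum.mono_neutral_right) (use A.finite_V B.finite_V zero in auto)
    finally show ?thesis .
  qed
  ultimately show "left_coeffs l \<in> der_coeffs E1 \<Delta>1 c1" unfolding der_coeffs_def by blast
qed

lemma T1_component_join_iso:
  "module_iso class_ring (T1_component E J c :: ('k::field, _) module) (T1_component E1 \<Delta>1 c1)"
  by (rule T1_component_isoI[OF J.complex A.complex bij_left_coeffs _ _ left_coeffs_der_coeffs_iff])
    (auto simp: left_coeffs_def)

lemma join_coeffs_trivial_iff:
  "hom_coeffs E J c \<subseteq> (der_coeffs E J c :: (('v \<Rightarrow>\<^sub>0 nat) \<Rightarrow> 'k::field) set) \<longleftrightarrow>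
   hom_coeffs E1 \<Delta>1 c1 \<subseteq> (der_coeffs E1 \<Delta>1 c1 :: (('v \<Rightarrow>\<^sub>0 nat) \<Rightarrow> 'k) set)"
  unfolding bij_betw_imp_surj_on[OF bij_left_coeffs, symmetric]
  using left_coeffs_der_coeffs_iff by blast

end
end

lemma complex_join_swap: "complex_join E1 E2 \<Delta>1 \<Delta>2 \<Longrightarrow> complex_join E2 E1 \<Delta>2 \<Delta>1"
  unfolding complex_join_def complex_join_axioms_def by (simp add: Int_commute)

lemma (in complex_join) neg_both_trivial:
  assumes "v1 \<in> E1" "c v1 < 0" "v2 \<in> E2" "c v2 < 0"
  shows "hom_coeffs E J c \<subseteq> der_coeffs E J c"
proof
  interpret S: complex_join E2 E1 \<Delta>2 \<Delta>1 by (rule complex_join_swap) (rule complex_join_axioms)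
  have swap: "E2 \<union> E1 = E" "simplicial_join \<Delta>2 \<Delta>1 = J"
    by (auto simp: simplicial_join_commute)
  fix l assume l: "l \<in> hom_coeffs E J c"
  show "l \<in> der_coeffs E J c"
  proof (rule der_coeffsI_zero)
    fix m assume "m \<in> admissible E J c"
    then have "Poly_Mapping.keys m \<inter> E1 \<notin> \<Delta>1 \<or> Poly_Mapping.keys m \<inter> E2 \<notin> \<Delta>2"
      using J.admissibleD(1,2) by (auto simp: join_iff)
    then show "l m = 0"
      using hom_coeffs_neg_right[OF l _ assms(3,4)] S.hom_coeffs_neg_right[unfolded swap, OF l _ assms(1,2)] by blast
  qed
qed

lemma (in complex_join) rigid_join_iff:
  "rigid TYPE('k::field) E J \<longleftrightarrow> rigid TYPE('k) E1 \<Delta>1 \<and> rigid TYPE('k) E2 \<Delta>2"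
proof -
  interpret S: complex_join E2 E1 \<Delta>2 \<Delta>1 by (rule complex_join_swap) (rule complex_join_axioms)
  have swap: "E2 \<union> E1 = E" "simplicial_join \<Delta>2 \<Delta>1 = J"
    by (auto simp: simplicial_join_commute)
  let ?triv = "\<lambda>V \<Delta> c. hom_coeffs V \<Delta> c \<subseteq> (der_coeffs V \<Delta> c :: (('v \<Rightarrow>\<^sub>0 nat) \<Rightarrow> 'k) set)"
  have "(\<forall>c. ?triv E J c) \<longleftrightarrow> (\<forall>c. ?triv E1 \<Delta>1 c) \<and> (\<forall>c. ?triv E2 \<Delta>2 c)"
  proof (intro iffI conjI allI)
    fix c :: "'v \<Rightarrow> int" assume triv: "\<forall>c. ?triv E J c"
    have "?triv E J (\<lambda>v. if v \<in> E1 then c v else 0) \<longleftrightarrow> ?triv E1 \<Delta>1 c"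
    proof (rule join_coeffs_trivial_iff)
      have "{v \<in> E2. (if v \<in> E1 then c v else 0) \<noteq> 0} = {}" using disjoint by auto
      then show "{v \<in> E2. (if v \<in> E1 then c v else 0) \<noteq> 0} \<in> \<Delta>2" using B.empty_face by (simp only:)
    qed (use disjoint in auto)
    with triv show "?triv E1 \<Delta>1 c" by blast
    have "?triv E J (\<lambda>v. if v \<in> E2 then c v else 0) \<longleftrightarrow> ?triv E2 \<Delta>2 c"
    proof (rule S.join_coeffs_trivial_iff[unfolded swap])
      have "{v \<in> E1. (if v \<in> E2 then c v else 0) \<noteq> 0} = {}" using disjoint by auto
      then show "{v \<in> E1. (if v \<in> E2 then c v else 0) \<noteq> 0} \<in> \<Delta>1" using A.empty_face by (simp only:)
    qed (use disjoint in auto)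
    with triv show "?triv E2 \<Delta>2 c" by blast
  next
    fix c :: "'v \<Rightarrow> int" assume triv: "(\<forall>c. ?triv E1 \<Delta>1 c) \<and> (\<forall>c. ?triv E2 \<Delta>2 c)"
    have "(\<exists>v\<in>E1. c v < 0) \<or> (\<forall>v\<in>E1. 0 \<le> c v)" "(\<exists>v\<in>E2. c v < 0) \<or> (\<forall>v\<in>E2. 0 \<le> c v)"
      by force+
    then consider "{v \<in> E. 0 < c v} \<notin> J"
      | v1 v2 where "v1 \<in> E1" "c v1 < 0" "v2 \<in> E2" "c v2 < 0"
      | "{v \<in> E. 0 < c v} \<in> J" "\<And>v. v \<in> E2 \<Longrightarrow> 0 \<le> c v"
      | "{v \<in> E. 0 < c v} \<in> J" "\<And>v. v \<in> E1 \<Longrightarrow> 0 \<le> c v"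
      by blast
    then show "?triv E J c"
    proof cases
      case 1
      then show ?thesis using pos_part_nonface_trivial by blast
    next
      case 2
      then show ?thesis by (rule neg_both_trivial)
    next
      case 3
      have "{v \<in> E2. c v \<noteq> 0} = {v \<in> E. 0 < c v} \<inter> E2" using 3(2) by force
      then have "{v \<in> E2. c v \<noteq> 0} \<in> \<Delta>2" using 3(1) unfolding join_iff by simp
      then have "?triv E J c \<longleftrightarrow> ?triv E1 \<Delta>1 c" by (intro join_coeffs_trivial_iff 3 refl)
      then show ?thesis using triv by blast
    next
      case 4
      have "{v \<in> E1. c v \<noteq> 0} = {v \<in> E. 0 < c v} \<inter> E1" using 4(2) by force
      then have "{v \<in> E1. c v \<noteq> 0} \<in> \<Delta>1" using 4(1) unfolding join_iff by simp
      then have "?triv E J c \<longleftrightarrow> ?triv E2 \<Delta>2 c" by (intro S.join_coeffs_trivial_iff[unfolded swap] 4 refl)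
      then show ?thesis using triv by blast
    qed
  qed
  then show ?thesis by (simp only: J.rigid_coeffs A.rigid_coeffs B.rigid_coeffs)
qed

theorem proposition2p3:
  fixes E1 E2 :: "'v set" and \<Delta>1 \<Delta>2 :: "'v set set"
  assumes "simplicial_complex E1 \<Delta>1" and "simplicial_complex E2 \<Delta>2"
    and "E1 \<inter> E2 = {}"
  shows
    "(\<forall>(a1 :: 'v \<Rightarrow> nat) (a2 :: 'v \<Rightarrow> nat) (b1 :: 'v \<Rightarrow> nat) (b2 :: 'v \<Rightarrow> nat).
        (\<forall>v. b1 v \<in> {0, 1}) \<and> (\<forall>v. b2 v \<in> {0, 1}) \<and>
        supp a1 \<inter> supp b1 = {} \<and> supp a2 \<inter> supp b2 = {} \<and>
        supp a1 \<union> supp b1 \<subseteq> vertices \<Delta>1 \<and> supp a2 \<union> supp b2 \<subseteq> vertices \<Delta>2 \<longrightarrow>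
        (let T = (T1_component (E1 \<union> E2) (simplicial_join \<Delta>1 \<Delta>2)
                    (\<lambda>v. int (a1 v) + int (a2 v) - int (b1 v) - int (b2 v))
                  :: ('k::field, _) module)
         in (b1 \<noteq> (\<lambda>_. 0) \<and> b2 \<noteq> (\<lambda>_. 0) \<longrightarrow> zero_module T) \<and>
            (supp a1 \<notin> \<Delta>1 \<or> supp a2 \<notin> \<Delta>2 \<longrightarrow> zero_module T) \<and>
            (b2 = (\<lambda>_. 0) \<and> supp a2 \<in> \<Delta>2 \<longrightarrow>
               module_iso class_ring T (T1_component E1 \<Delta>1 (\<lambda>v. int (a1 v) - int (b1 v)))) \<and>
            (b1 = (\<lambda>_. 0) \<and> supp a1 \<in> \<Delta>1 \<longrightarrow>
               module_iso class_ring T (T1_component E2 \<Delta>2 (\<lambda>v. int (a2 v) - int (b2 v)))))) \<and>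
     (rigid TYPE('k) (E1 \<union> E2) (simplicial_join \<Delta>1 \<Delta>2) \<longleftrightarrow>
        rigid TYPE('k) E1 \<Delta>1 \<and> rigid TYPE('k) E2 \<Delta>2)"
proof -
  interpret complex_join E1 E2 \<Delta>1 \<Delta>2
    using assms by unfold_locales
  interpret S: complex_join E2 E1 \<Delta>2 \<Delta>1 by (rule complex_join_swap) (rule complex_join_axioms)
  have swap: "E2 \<union> E1 = E" "simplicial_join \<Delta>2 \<Delta>1 = J"
    by (auto simp: simplicial_join_commute)
  show ?thesis
    unfolding Let_def
  proof (intro conjI allI impI rigid_join_iff)
    fix a1 a2 b1 b2 :: "'v \<Rightarrow> nat"
    let ?c = "\<lambda>v. int (a1 v) + int (a2 v) - int (b1 v) - int (b2 v)"
    let ?T = "T1_component E J ?c :: ('k, _) module"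
    assume ab: "(\<forall>v. b1 v \<in> {0, 1}) \<and> (\<forall>v. b2 v \<in> {0, 1}) \<and>
        supp a1 \<inter> supp b1 = {} \<and> supp a2 \<inter> supp b2 = {} \<and>
        supp a1 \<union> supp b1 \<subseteq> vertices \<Delta>1 \<and> supp a2 \<union> supp b2 \<subseteq> vertices \<Delta>2"
    have supp_E: "supp a1 \<subseteq> E1" "supp b1 \<subseteq> E1" "supp a2 \<subseteq> E2" "supp b2 \<subseteq> E2"
      using ab A.faces_subset B.faces_subset by (fastforce simp: vertices_def)+
    have off: "a1 v = 0" "b1 v = 0" if "v \<in> E2" for v using supp_E that disjoint by (auto simp: supp_def)
    have off': "a2 v = 0" "b2 v = 0" if "v \<in> E1" for v using supp_E that disjoint by (auto simp: supp_def)
    have excl: "a1 v = 0 \<or> b1 v = 0" "a2 v = 0 \<or> b2 v = 0" for v using ab by (auto simp: supp_def)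
    show "zero_module ?T" if b: "b1 \<noteq> (\<lambda>_. 0) \<and> b2 \<noteq> (\<lambda>_. 0)"
    proof -
      obtain v1 v2 where v: "b1 v1 \<noteq> 0" "b2 v2 \<noteq> 0" using b by (auto simp: fun_eq_iff)
      then have E: "v1 \<in> E1" "v2 \<in> E2" using supp_E by (auto simp: supp_def)
      show ?thesis unfolding J.zero_T1_component_coeffs
        by (rule neg_both_trivial[OF E(1) _ E(2)])
          (use v E off[of v2] off'[of v1] excl(1)[of v1] excl(2)[of v2] in auto)
    qed
    show "zero_module ?T" if a: "supp a1 \<notin> \<Delta>1 \<or> supp a2 \<notin> \<Delta>2"
    proof -
      have "supp a1 \<subseteq> {v \<in> E. 0 < ?c v} \<inter> E1"
      proof
        fix v assume "v \<in> supp a1"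
        then show "v \<in> {v \<in> E. 0 < ?c v} \<inter> E1" using supp_E off'[of v] excl(1)[of v] by (auto simp: supp_def)
      qed
      moreover have "supp a2 \<subseteq> {v \<in> E. 0 < ?c v} \<inter> E2"
      proof
        fix v assume "v \<in> supp a2"
        then show "v \<in> {v \<in> E. 0 < ?c v} \<inter> E2" using supp_E off[of v] excl(2)[of v] by (auto simp: supp_def)
      qed
      ultimately have "{v \<in> E. 0 < ?c v} \<notin> J"
        using a A.face_mono B.face_mono unfolding join_iff by blast
      then show ?thesis unfolding J.zero_T1_component_coeffs by (intro subsetI pos_part_nonface_trivial)
    qed
    show "module_iso class_ring ?T (T1_component E1 \<Delta>1 (\<lambda>v. int (a1 v) - int (b1 v)))"
      if b: "b2 = (\<lambda>_. 0) \<and> supp a2 \<in> \<Delta>2"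
    proof (rule T1_component_join_iso)
      have "{v \<in> E2. ?c v \<noteq> 0} = supp a2" using b off supp_E by (auto simp: supp_def)
      then show "{v \<in> E2. ?c v \<noteq> 0} \<in> \<Delta>2" using b by simp
    qed (use b off off' in auto)
    show "module_iso class_ring ?T (T1_component E2 \<Delta>2 (\<lambda>v. int (a2 v) - int (b2 v)))"
      if b: "b1 = (\<lambda>_. 0) \<and> supp a1 \<in> \<Delta>1"
    proof (rule S.T1_component_join_iso[unfolded swap])
      have "{v \<in> E1. ?c v \<noteq> 0} = supp a1" using b off' supp_E by (auto simp: supp_def)
      then show "{v \<in> E1. ?c v \<noteq> 0} \<in> \<Delta>1" using b by simp
    qed (use b off off' in auto)
  qed
qed

end
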